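(* Let $\alpha\in(0,1]$ and let $c>1$. For any unitary, Virasoro invariant, modular invariant 2D CFT with central charge $c$ (in the sense of the context), define $$\mathcal{E}^{\rm Vir}(\beta_L,\beta_R)=\log Z^{\rm Vir}(\beta_L,\beta_R)-\frac{c-1}{24}(\beta_L+\beta_R).$$ Then for every $(\beta_L,\beta_R)\in\mathcal{D}_\alpha$, the algorithm $\mathsf{A}_\alpha$ started at $(\beta_L,\beta_R)$ stops after finitely many points $(\beta_L^{(1)},\beta_R^{(1)}),\dots,(\beta_L^{(N)},\beta_R^{(N)})$, and $$\mathcal{E}^{\rm Vir}(\beta_L,\beta_R)\leqslant\log\Bigg[\sum_{i=1}^N\Big(\prod_{j=2}^{i}\sqrt{\tfrac{\beta_L^{(j)}\beta_R^{(j)}}{4\pi^2}}\Big)\tilde Z_L^{\rm Vir}\big(\alpha;\beta_L^{(i)},\beta_R^{(i)}\big)+\Big(\prod_{j=2}^{N}\sqrt{\tfrac{\beta_L^{(j)}\beta_R^{(j)}}{4\pi^2}}\Big)\tilde Z_H^{\rm Vir}\big(\alpha;\beta_L^{(N)},\beta_R^{(N)}\big)\Bigg],$$ where empty products equal $1$.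
   Context: Let $\eta(\beta)=e^{-\beta/24}\prod_{n\geqslant1}(1-e^{-n\beta})$. A unitary, Virasoro invariant, modular invariant 2D CFT with central charge $c>1$ is given by a countable set of Virasoro primary weights $(h,\bar h)$, $h,\bar h\geqslant0$, with multiplicities $n_{h,\bar h}\in\mathbb{N}$, where the vacuum $(0,0)$ has multiplicity $1$ and primaries with $h=0$ or $\bar h=0$ other than the vacuum have the form $(J,0)$ or $(0,J)$ with $J$ a positive integer; the partition function is $Z(\beta_L,\beta_R)=\sum n_{h,\bar h}\chi_h(\beta_L)\chi_{\bar h}(\beta_R)$ with $\chi_0(\beta)=\frac{e^{\frac{c-1}{24}\beta}}{\eta(\beta)}(1-e^{-\beta})$ and $\chi_h(\beta)=\frac{e^{\frac{c-1}{24}\beta}}{\eta(\beta)}e^{-h\beta}$ for $h>0$; $Z$ is finite for all $\beta_L,\beta_R>0$ and $Z(\beta_L,\beta_R)=Z(4\pi^2/\beta_L,4\pi^2/\beta_R)$. Set $Z^{\rm Vir}(\beta_L,\beta_R)=Z(\beta_L,\beta_R)\eta(\beta_L)\eta(\beta_R)$. Define $$\tilde Z_L^{\rm Vir}(\alpha;\beta_L,\beta_R)=(1-e^{-\beta_L})(1-e^{-\beta_R})+\sum_{0<\min(h,\bar h)<\frac{\alpha(c-1)}{24}}n_{h,\bar h}e^{-h\beta_L-\bar h\beta_R}+\sum_{J\geqslant1}n_{J,0}e^{-J\beta_L}(1-e^{-\beta_R})+\sum_{J\geqslant1}n_{0,J}(1-e^{-\beta_L})e^{-J\beta_R},$$ $$\tilde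 Z_H^{\rm Vir}(\alpha;\beta_L,\beta_R)=\sum_{h,\bar h\geqslant\frac{\alpha(c-1)}{24}}n_{h,\bar h}e^{-h\beta_L-\bar h\beta_R}.$$ Let $\phi_\alpha(\beta)=\max\left\{\frac{4\pi^2}{\beta},\ \frac12\left(\alpha(4\pi-\beta)+\sqrt{\alpha^2(4\pi-\beta)^2+16\pi^2(1-\alpha)}\right)\right\}$ and $\mathcal{D}_\alpha=\{\beta_R>2\pi,\ \beta_L>\phi_\alpha(\beta_R)\}\cup\{\beta_L>2\pi,\ \beta_R>\phi_\alpha(\beta_L)\}$. Algorithm $\mathsf{A}_\alpha$: set $(\beta_L^{(1)},\beta_R^{(1)})=(\beta_L,\beta_R)$. Given $(b_L,b_R)=(\beta_L^{(i)},\beta_R^{(i)})$: (1) if $b_L>2\pi$ and $b_R>2\pi$, stop, $N=i$. (2) If $b_L\leqslant2\pi$: put $\tilde b_L=b_L$ if $b_L<2\pi$, $\tilde b_L=\frac{8\pi^2}{\alpha(b_R-2\pi)+4\pi}$ if $b_L=2\pi$; let $t>0$ be the unique positive solution of $\alpha b_R+\tilde b_L-\frac{4\pi^2}{\tilde b_L}+(1-\alpha)\frac{4\pi^2}{t}-t=0$; set $(\beta_L^{(i+1)},\beta_R^{(i+1)})=(4\pi^2/\tilde b_L,\ t)$. (3) Otherwise ($b_L>2\pi$, $b_R\leqslant2\pi$): the same with $L$ and $R$ exchanged, giving $(\beta_L^{(i+1)},\beta_R^{(i+1)})=(t,\ 4\pi^2/\tilde b_R)$ with $\tilde b_R=b_R$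 if $b_R<2\pi$, $\tilde b_R=\frac{8\pi^2}{\alpha(b_L-2\pi)+4\pi}$ if $b_R=2\pi$, and $t>0$ solving $\alpha b_L+\tilde b_R-\frac{4\pi^2}{\tilde b_R}+(1-\alpha)\frac{4\pi^2}{t}-t=0$. *)

theory Defs
  imports "HOL-Analysis.Analysis"
begin

definition eta :: "real \<Rightarrow> real" where
  "eta \<beta> = exp (-\<beta>/24) * (\<Prod>n. 1 - exp (- real (Suc n) * \<beta>))"

definition chi :: "real \<Rightarrow> real \<Rightarrow> real \<Rightarrow> real" where
  "chi c h \<beta> = (if h = 0 then exp ((c - 1) / 24 * \<beta>) / eta \<beta> * (1 - exp (-\<beta>))
                else exp ((c - 1) / 24 * \<beta>) / eta \<beta> * exp (- h * \<beta>))"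

text \<open>A spectrum is a multiplicity function on weights (h, hbar); its support is the set of primaries.\<close>
definition Zpart :: "real \<Rightarrow> (real \<times> real \<Rightarrow> nat) \<Rightarrow> real \<Rightarrow> real \<Rightarrow> real" where
  "Zpart c n \<beta>L \<beta>R = (\<Sum>\<^sub>\<infinity>p\<in>{p. n p \<noteq> 0}. real (n p) * chi c (fst p) \<beta>L * chi c (snd p) \<beta>R)"

definition is_CFT :: "real \<Rightarrow> (real \<times> real \<Rightarrow> nat) \<Rightarrow> bool" where
  "is_CFT c n \<longleftrightarrow>
     countable {p. n p \<noteq> 0} \<and>
     n (0, 0) = 1 \<and>
     (\<forall>h hb. n (h, hb) \<noteq> 0 \<longrightarrow> h \<ge> 0 \<and> hb \<ge> 0) \<and>
     (\<forall>h hb. n (h, hb) \<noteq> 0 \<longrightarrow> (h = 0 \<or> hb = 0) \<longrightarrow> (h, hb) \<noteq> (0, 0) \<longrightarrow>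
        (\<exists>J::nat. J \<ge> 1 \<and> ((h, hb) = (real J, 0) \<or> (h, hb) = (0, real J)))) \<and>
     (\<forall>\<beta>L \<beta>R. \<beta>L > 0 \<longrightarrow> \<beta>R > 0 \<longrightarrow>
        (\<lambda>p. real (n p) * chi c (fst p) \<beta>L * chi c (snd p) \<beta>R) summable_on {p. n p \<noteq> 0}) \<and>
     (\<forall>\<beta>L \<beta>R. \<beta>L > 0 \<longrightarrow> \<beta>R > 0 \<longrightarrow>
        Zpart c n \<beta>L \<beta>R = Zpart c n (4 * pi\<^sup>2 / \<beta>L) (4 * pi\<^sup>2 / \<beta>R))"

definition ZVir :: "real \<Rightarrow> (real \<times> real \<Rightarrow> nat) \<Rightarrow> real \<Rightarrow> real \<Rightarrow> real" where
  "ZVir c n \<beta>L \<beta>R = Zpart c n \<beta>L \<beta>R * eta \<beta>L * eta \<beta>R"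

definition EVir :: "real \<Rightarrow> (real \<times> real \<Rightarrow> nat) \<Rightarrow> real \<Rightarrow> real \<Rightarrow> real" where
  "EVir c n \<beta>L \<beta>R = ln (ZVir c n \<beta>L \<beta>R) - (c - 1) / 24 * (\<beta>L + \<beta>R)"

definition ZL_tilde :: "real \<Rightarrow> (real \<times> real \<Rightarrow> nat) \<Rightarrow> real \<Rightarrow> real \<Rightarrow> real \<Rightarrow> real" where
  "ZL_tilde c n \<alpha> \<beta>L \<beta>R =
     (1 - exp (-\<beta>L)) * (1 - exp (-\<beta>R))
     + (\<Sum>\<^sub>\<infinity>p\<in>{p. n p \<noteq> 0 \<and> 0 < min (fst p) (snd p) \<and> min (fst p) (snd p) < \<alpha> * (c - 1) / 24}.
          real (n p) * exp (- fst p * \<beta>L - snd p * \<beta>R))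
     + (\<Sum>\<^sub>\<infinity>J\<in>{1::nat..}. real (n (real J, 0)) * exp (- real J * \<beta>L) * (1 - exp (-\<beta>R)))
     + (\<Sum>\<^sub>\<infinity>J\<in>{1::nat..}. real (n (0, real J)) * (1 - exp (-\<beta>L)) * exp (- real J * \<beta>R))"

definition ZH_tilde :: "real \<Rightarrow> (real \<times> real \<Rightarrow> nat) \<Rightarrow> real \<Rightarrow> real \<Rightarrow> real \<Rightarrow> real" where
  "ZH_tilde c n \<alpha> \<beta>L \<beta>R =
     (\<Sum>\<^sub>\<infinity>p\<in>{p. n p \<noteq> 0 \<and> fst p \<ge> \<alpha> * (c - 1) / 24 \<and> snd p \<ge> \<alpha> * (c - 1) / 24}.
          real (n p) * exp (- fst p * \<beta>L - snd p * \<beta>R))"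

definition phi :: "real \<Rightarrow> real \<Rightarrow> real" where
  "phi \<alpha> \<beta> = max (4 * pi\<^sup>2 / \<beta>)
     ((\<alpha> * (4 * pi - \<beta>) + sqrt (\<alpha>\<^sup>2 * (4 * pi - \<beta>)\<^sup>2 + 16 * pi\<^sup>2 * (1 - \<alpha>))) / 2)"

definition domD :: "real \<Rightarrow> (real \<times> real) set" where
  "domD \<alpha> = {(\<beta>L, \<beta>R). \<beta>R > 2 * pi \<and> \<beta>L > phi \<alpha> \<beta>R}
           \<union> {(\<beta>L, \<beta>R). \<beta>L > 2 * pi \<and> \<beta>R > phi \<alpha> \<beta>L}"

text \<open>One step of algorithm A_alpha (applied when the current point is not a stopping point).
  b is the coordinate that is <= 2 pi, a the other one.\<close>
definition tilde_b :: "real \<Rightarrow> real \<Rightarrow> real \<Rightarrow> real" where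
  "tilde_b \<alpha> b a = (if b < 2 * pi then b else 8 * pi\<^sup>2 / (\<alpha> * (a - 2 * pi) + 4 * pi))"

definition t_sol :: "real \<Rightarrow> real \<Rightarrow> real \<Rightarrow> real" where
  "t_sol \<alpha> a bt = (THE t. t > 0 \<and> \<alpha> * a + bt - 4 * pi\<^sup>2 / bt + (1 - \<alpha>) * 4 * pi\<^sup>2 / t - t = 0)"

definition alg_step :: "real \<Rightarrow> real \<times> real \<Rightarrow> real \<times> real" where
  "alg_step \<alpha> b =
     (let bL = fst b; bR = snd b in
      if bL \<le> 2 * pi then
        (let bt = tilde_b \<alpha> bL bR in (4 * pi\<^sup>2 / bt, t_sol \<alpha> bR bt))
      else
        (let bt = tilde_b \<alpha> bR bL in (t_sol \<alpha> bL bt, 4 * pi\<^sup>2 / bt)))"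

text \<open>alg_pt alpha start i is the point (beta_L^(i), beta_R^(i)) for i >= 1 (1-based as in the paper).\<close>
definition alg_pt :: "real \<Rightarrow> real \<times> real \<Rightarrow> nat \<Rightarrow> real \<times> real" where
  "alg_pt \<alpha> b0 i = (alg_step \<alpha> ^^ (i - 1)) b0"

definition alg_stop :: "real \<times> real \<Rightarrow> bool" where
  "alg_stop b \<longleftrightarrow> fst b > 2 * pi \<and> snd b > 2 * pi"

end

theory Submission
  imports Defs
begin

text \<open>Up to the factor \<open>exp (- (c - 1) / 24 * (\<beta>\<^sub>L + \<beta>\<^sub>R))\<close>, \<open>ZVir\<close> is the sum of its light and heavy
  parts. A heavy term at \<open>(b, a)\<close> is at most \<open>exp (- \<alpha> (c - 1) / 24 * (a - s))\<close> times the same term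
  at \<open>(bt, s)\<close>, where \<open>bt \<le> b\<close> and \<open>s \<le> a\<close>; a modular transformation then takes \<open>(bt, s)\<close> to
  \<open>(4\<pi>\<^sup>2/bt, 4\<pi>\<^sup>2/s)\<close>, and the equation for \<open>t = 4\<pi>\<^sup>2/s\<close> says precisely that all exponentials cancel.
  So each step bounds the heavy part by a square root factor times the full function at the next
  point, and iteration gives the claim.

  The square root factor comes from the modularity of \<open>eta\<close>, proved by comparing, at \<open>\<beta>\<close> and
  \<open>4\<pi>\<^sup>2/\<beta>\<close>, the double series obtained from the logarithm of the Euler product and the partial
  fractions of \<open>1 / (exp x - 1)\<close>.

  For termination, the domain is invariant and carries a conserved quantity, which bounds from
  below the amount by which each step decreases the larger coordinate.\<close>

subsection \<open>Modularity of the eta function\<close>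

lemma sinh_product_formula:
  fixes y :: real
  assumes "y \<noteq> 0"
  shows "(\<lambda>n. \<Prod>k=1..n. 1 + y\<^sup>2 / (real k)\<^sup>2) \<longlonglongrightarrow> sinh (pi * y) / (pi * y)"
proof -
  \<comment> \<open>Euler's sine product at an imaginary point has real factors; the common factor
    \<open>\<i>\<close> is removed at the end by multiplying with \<open>-\<i>\<close>.\<close>
  have "(\<lambda>n. of_real pi * (\<i> * of_real y) * (\<Prod>k=1..n. 1 - (\<i> * of_real y)\<^sup>2 / (of_nat k)\<^sup>2))
          \<longlonglongrightarrow> sin (of_real pi * (\<i> * of_real y))"
    by (rule sin_product_formula_complex)
  also have "sin (of_real pi * (\<i> * of_real y)) = \<i> * of_real (sinh (pi * y))"
  proof -
    have "sinh (of_real (pi * y)) = complex_of_real (sinh (pi * y))"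
      by (simp add: sinh_field_def exp_of_real [symmetric] exp_minus)
    then show ?thesis
      using sinh_conv_sin[of "complex_of_real (pi * y)"] by (simp add: mult_ac)
  qed
  also have "(\<lambda>n. of_real pi * (\<i> * of_real y) * (\<Prod>k=1..n. 1 - (\<i> * of_real y)\<^sup>2 / (of_nat k)\<^sup>2)) =
     (\<lambda>n. \<i> * of_real (pi * y * (\<Prod>k=1..n. 1 + y\<^sup>2 / (real k)\<^sup>2)))"
    by (simp add: power_mult_distrib mult_ac)
  finally have lim: "(\<lambda>n. -\<i> * (\<i> * complex_of_real (pi * y * (\<Prod>k=1..n. 1 + y\<^sup>2 / (real k)\<^sup>2))))
      \<longlonglongrightarrow> -\<i> * (\<i> * of_real (sinh (pi * y)))"
    by (rule tendsto_mult[OF tendsto_const])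
  have eq: "-\<i> * (\<i> * z) = z" for z by simp
  from lim have "(\<lambda>n. complex_of_real (pi * y * (\<Prod>k=1..n. 1 + y\<^sup>2 / (real k)\<^sup>2)))
      \<longlonglongrightarrow> of_real (sinh (pi * y))"
    unfolding eq .
  then have "(\<lambda>n. pi * y * (\<Prod>k=1..n. 1 + y\<^sup>2 / (real k)\<^sup>2)) \<longlonglongrightarrow> sinh (pi * y)"
    by (subst (asm) tendsto_of_real_iff)
  from tendsto_divide[OF this tendsto_const[of "pi * y"]] assms show ?thesis
    by simp
qed

lemma ln_sinh_sums:
  fixes y :: real
  assumes "y > 0"
  shows "(\<lambda>k. ln (1 + y\<^sup>2 / (real (Suc k))\<^sup>2)) sums ln (sinh (pi * y) / (pi * y))"
proof -
  have pos: "1 + y\<^sup>2 / (real k)\<^sup>2 > 0" for k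
    by (intro add_pos_nonneg) auto
  have "(\<lambda>n. ln (\<Prod>k=1..n. 1 + y\<^sup>2 / (real k)\<^sup>2)) \<longlonglongrightarrow> ln (sinh (pi * y) / (pi * y))"
    using assms by (intro tendsto_ln sinh_product_formula) auto
  also have "(\<lambda>n. ln (\<Prod>k=1..n. 1 + y\<^sup>2 / (real k)\<^sup>2)) = (\<lambda>n. \<Sum>k<n. ln (1 + y\<^sup>2 / (real (Suc k))\<^sup>2))"
  proof
    fix n
    have "ln (\<Prod>k=1..n. 1 + y\<^sup>2 / (real k)\<^sup>2) = (\<Sum>k=1..n. ln (1 + y\<^sup>2 / (real k)\<^sup>2))"
      by (intro ln_prod) (use pos in \<open>auto simp: less_imp_neq[symmetric]\<close>)
    also have "\<dots> = (\<Sum>k<n. ln (1 + y\<^sup>2 / (real (Suc k))\<^sup>2))"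
      by (simp add: sum.atLeast1_atMost_eq del: of_nat_Suc)
    finally show "ln (\<Prod>k=1..n. 1 + y\<^sup>2 / (real k)\<^sup>2) = \<dots>" .
  qed
  finally show ?thesis by (simp add: sums_def)
qed

text \<open>Logarithmic derivative of the product for \<open>sinh\<close>, taken term by term; on a
  bounded interval the derivatives are dominated by a multiple of the inverse squares.\<close>

lemma coth_partial_fractions:
  fixes y :: real
  assumes "y > 0"
  shows "(\<lambda>k. 2 * y / ((real (Suc k))\<^sup>2 + y\<^sup>2)) sums (pi * cosh (pi * y) / sinh (pi * y) - 1 / y)"
proof -
  define f where "f = (\<lambda>k y. ln (1 + y\<^sup>2 / (real (Suc k))\<^sup>2))"
  define f' where "f' = (\<lambda>k y. 2 * y / ((real (Suc k))\<^sup>2 + y\<^sup>2))"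
  \<comment> \<open>Any bounded interval with \<open>y\<close> in its interior serves; the bound
    \<open>2 * y\<close> produces the constant \<open>4 * y\<close> below.\<close>
  define S where "S = {0..2*y}"
  have sq: "summable (\<lambda>k. 1 / (real (Suc k))\<^sup>2)"
    using inverse_squares_sums by (simp add: sums_iff add_ac)
  have bound: "norm (f' k x) \<le> 4 * y * (1 / (real (Suc k))\<^sup>2)" if "x \<in> S" for k x
  proof -
    have "f' k x \<le> 2 * (2 * y) / (real (Suc k))\<^sup>2"
      unfolding f'_def using that assms by (intro frac_le) (auto simp: S_def)
    moreover have "f' k x \<ge> 0" using that by (auto simp: f'_def S_def)
    ultimately show ?thesis by simp
  qed
  have sum': "summable (\<lambda>k. 4 * y * (1 / (real (Suc k))\<^sup>2))"
    by (intro summable_mult sq)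
  have unif: "uniformly_convergent_on S (\<lambda>n x. \<Sum>k<n. f' k x)"
    by (rule Weierstrass_m_test'[OF _ sum']) (use bound in auto)
  have der: "(f k has_field_derivative f' k x) (at x within S)" for k x
  proof -
    have "((\<lambda>x. ln (1 + x\<^sup>2 / a)) has_field_derivative (2 * x / (a + x\<^sup>2))) (at x within S)"
      if "a > 0" for a :: real
    proof -
      have "1 + x\<^sup>2 / a > 0" "a + x\<^sup>2 > 0" using that by (simp_all add: add_pos_nonneg)
      then show ?thesis using that
        by (auto intro!: derivative_eq_intros simp: field_simps)
    qed
    from this[of "(real (Suc k))\<^sup>2"] show ?thesis by (simp add: f_def f'_def)
  qed
  have int: "y \<in> interior S" using assms by (simp add: S_def)
  have "((\<lambda>x. \<Sum>k. f k x) has_field_derivative (\<Sum>k. f' k y)) (at y)"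
    by (rule has_field_derivative_series'[where S = S and ?x0.0 = y])
       (use der unif assms int ln_sinh_sums[OF assms] in \<open>auto simp: S_def f_def sums_iff\<close>)
  moreover have "((\<lambda>x. ln (sinh (pi * x) / (pi * x))) has_field_derivative
      (pi * cosh (pi * y) / sinh (pi * y) - 1 / y)) (at y)"
  proof -
    have "sinh (pi * y) > 0" using assms by simp
    then show ?thesis using assms
      by (auto intro!: derivative_eq_intros simp: field_simps power2_eq_square)
  qed
  \<comment> \<open>The closed form of the series is known only for positive arguments, which is
    enough in a neighbourhood of \<open>y\<close>.\<close>
  then have "((\<lambda>x. \<Sum>k. f k x) has_field_derivative
      (pi * cosh (pi * y) / sinh (pi * y) - 1 / y)) (at y)"
    by (rule has_field_derivative_transform_within_open[where S = "{0<..}"])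
       (use assms ln_sinh_sums in \<open>auto simp: f_def sums_iff\<close>)
  ultimately have eq: "(\<Sum>k. f' k y) = pi * cosh (pi * y) / sinh (pi * y) - 1 / y"
    by (rule DERIV_unique)
  have "summable (\<lambda>k. f' k y)"
    by (rule summable_comparison_test'[OF sum', of 0]) (use bound assms in \<open>auto simp: S_def\<close>)
  with eq show ?thesis unfolding f'_def by (simp add: sums_iff)
qed

lemma bose_partial_fractions:
  fixes x :: real
  assumes "x > 0"
  shows "(\<lambda>m. 2 * x / (x\<^sup>2 + 4 * pi\<^sup>2 * (real (Suc m))\<^sup>2)) sums (1 / (exp x - 1) - 1 / x + 1 / 2)"
proof -
  \<comment> \<open>With this scaling, \<open>1 / (exp x - 1)\<close> is half of
    \<open>coth (pi * y) - 1\<close>.\<close>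
  define y where "y = x / (2 * pi)"
  have y: "y > 0" "x = 2 * pi * y" using assms by (auto simp: y_def)
  have "(\<lambda>k. (1 / (2 * pi)) * (2 * y / ((real (Suc k))\<^sup>2 + y\<^sup>2))) sums
      ((1 / (2 * pi)) * (pi * cosh (pi * y) / sinh (pi * y) - 1 / y))"
    by (intro sums_mult coth_partial_fractions y)
  also have "(\<lambda>k. (1 / (2 * pi)) * (2 * y / ((real (Suc k))\<^sup>2 + y\<^sup>2))) =
     (\<lambda>m. 2 * x / (x\<^sup>2 + 4 * pi\<^sup>2 * (real (Suc m))\<^sup>2))"
  proof
    fix k
    have "(real (Suc k))\<^sup>2 + y\<^sup>2 > 0" using y by (intro add_nonneg_pos) auto
    moreover have "x\<^sup>2 + 4 * pi\<^sup>2 * (real (Suc k))\<^sup>2 = 4 * pi\<^sup>2 * ((real (Suc k))\<^sup>2 + y\<^sup>2)"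
      by (simp add: y(2) power_mult_distrib distrib_left del: of_nat_Suc)
    ultimately show "(1 / (2 * pi)) * (2 * y / ((real (Suc k))\<^sup>2 + y\<^sup>2)) =
       2 * x / (x\<^sup>2 + 4 * pi\<^sup>2 * (real (Suc k))\<^sup>2)"
      by (simp add: y(2) power2_eq_square del: of_nat_Suc)
  qed
  also have "(1 / (2 * pi)) * (pi * cosh (pi * y) / sinh (pi * y) - 1 / y) = 1 / (exp x - 1) - 1 / x + 1 / 2"
  proof -
    have "exp x = exp (pi * y) * exp (pi * y)"
      by (simp add: y(2) exp_add [symmetric])
    moreover have "exp (pi * y) > 1" using y by simp
    moreover have "cosh (pi * y) / sinh (pi * y) = 2 * (1 / (E * E - 1)) + 1" if "E > 1" "exp (pi * y) = E" for E
    proof -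
      have "E * E > 1" using that by (metis less_1_mult)
      then show ?thesis using that by (simp add: cosh_def sinh_def exp_minus field_simps)
    qed
    ultimately have "cosh (pi * y) / sinh (pi * y) = 2 * (1 / (exp x - 1)) + 1" by simp
    moreover have "(1 / (2 * pi)) * (pi * cosh (pi * y) / sinh (pi * y) - 1 / y)
       = (1/2) * (cosh (pi * y) / sinh (pi * y)) - 1 / x"
      by (simp add: y(2) field_simps)
    ultimately show ?thesis by simp
  qed
  finally show ?thesis .
qed

section \<open>The logarithm of the Euler product\<close>

lemma neg_ln_one_minus_sums:
  fixes x :: real
  assumes "\<bar>x\<bar> < 1"
  shows "(\<lambda>k. x ^ Suc k / real (Suc k)) sums (- ln (1 - x))"
proof -
  have "(\<lambda>n. - (x ^ n) / real n) sums ln (1 - x)"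
    using ln_series'[of "-x"] assms by simp
  then have "(\<lambda>n. x ^ n / real n) sums (- ln (1 - x))"
    using sums_minus by fastforce
  \<comment> \<open>The term at index 0 is a division by zero, hence 0, so the shift of the index
    leaves the sum unchanged.\<close>
  then show ?thesis by (subst sums_Suc_iff) simp
qed

text \<open>Expanding each logarithm gives a double series with nonnegative terms
  \<open>q ^ (n * k) / k\<close> over positive \<open>n\<close> and \<open>k\<close>. The order of
  summation may thus be exchanged, and the sum over \<open>n\<close> is geometric.\<close>

lemma euler_product_ln:
  fixes \<beta> :: real
  assumes "\<beta> > 0"
  shows "(\<Prod>n. 1 - exp (- real (Suc n) * \<beta>)) > 0"
    and "(\<lambda>k. 1 / (real (Suc k) * (exp (real (Suc k) * \<beta>) - 1)))
           sums (- ln (\<Prod>n. 1 - exp (- real (Suc n) * \<beta>)))"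
proof -
  define q where "q = exp (-\<beta>)"
  have q: "0 < q" "q < 1" using assms by (auto simp: q_def)
  have qp: "exp (- real (Suc n) * \<beta>) = q ^ Suc n" for n
    by (simp only: q_def exp_of_nat_mult [symmetric] mult_minus_left mult_minus_right)
  have qlt: "q ^ Suc n < 1" for n using q by (intro power_Suc_less_one) auto
  have conv: "convergent_prod (\<lambda>n. 1 - exp (- real (Suc n) * \<beta>))"
  proof -
    have "convergent_prod (\<lambda>n. 1 + (- (q ^ Suc n)))"
    proof (rule summable_imp_convergent_prod_real)
      show "summable (\<lambda>k. \<bar>- (q ^ Suc k)\<bar>)"
        using q by (simp add: summable_mult)
      show "- (q ^ Suc k) \<noteq> -1" for k using qlt[of k] by simp
    qed
    then show ?thesis by (simp only: qp) simp
  qed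
  have pos: "1 - exp (- real (Suc n) * \<beta>) > 0" for n using qlt[of n] by (simp only: qp)
  show "(\<Prod>n. 1 - exp (- real (Suc n) * \<beta>)) > 0"
    using conv pos by (intro less_0_prodinf) auto
  define S where "S = - ln (\<Prod>n. 1 - exp (- real (Suc n) * \<beta>))"
  define f where "f = (\<lambda>(n,k). (q ^ Suc n) ^ Suc k / real (Suc k))"
  have fnn: "f p \<ge> 0" for p using q by (auto simp: f_def split: prod.splits)
  have 1: "((\<lambda>k. f (n,k)) has_sum (- ln (1 - q ^ Suc n))) UNIV" for n
    unfolding f_def using neg_ln_one_minus_sums[of "q ^ Suc n"] qlt[of n] q
    by (intro sums_nonneg_imp_has_sum) auto
  have lnn: "- ln (1 - q ^ Suc n) \<ge> 0" for n
    using qlt[of n] q by (simp del: power_Suc)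
  have "(\<lambda>n. ln (1 - exp (- real (Suc n) * \<beta>))) sums ln (\<Prod>n. 1 - exp (- real (Suc n) * \<beta>))"
    unfolding sums_iff using suminf_ln_real[OF conv pos] summable_ln_real[OF conv pos] by simp
  then have "(\<lambda>n. - ln (1 - q ^ Suc n)) sums S"
    unfolding S_def qp by (rule sums_minus)
  then have 2: "((\<lambda>n. - ln (1 - q ^ Suc n)) has_sum S) UNIV"
    using lnn by (rule sums_nonneg_imp_has_sum)
  have "f summable_on (UNIV \<times> UNIV)"
    by (rule summable_on_SigmaI[OF 1]) (use 2 fnn in \<open>auto simp: summable_on_def\<close>)
  then have "(f has_sum S) (UNIV \<times> UNIV)"
    by (intro has_sum_SigmaI[OF 1 2])
  then have 3: "((\<lambda>(k,n). f (n,k)) has_sum S) (UNIV \<times> UNIV)"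
    by (subst (asm) has_sum_swap)
  have 4: "((\<lambda>n. (\<lambda>(k,n). f (n,k)) (k, n)) has_sum (1 / (real (Suc k) * (exp (real (Suc k) * \<beta>) - 1)))) UNIV" for k
  proof -
    define r where "r = q ^ Suc k"
    have r: "0 < r" "r < 1" using q qlt[of k] by (auto simp: r_def)
    have "(\<lambda>n. r * r ^ n / real (Suc k)) sums (r * (1 / (1 - r)) / real (Suc k))"
      using r by (intro sums_divide sums_mult geometric_sums) auto
    moreover have "f (n,k) = r * r ^ n / real (Suc k)" for n
    proof -
      have "(q ^ Suc n) ^ Suc k = (q ^ Suc k) ^ Suc n"
        by (simp only: power_mult [symmetric] mult.commute)
      then show ?thesis unfolding f_def r_def by simp
    qed
    moreover have er: "exp (real (Suc k) * \<beta>) = 1 / r"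
      unfolding r_def qp [symmetric] by (simp add: exp_minus inverse_eq_divide del: of_nat_Suc)
    then have "r * (1 / (1 - r)) / real (Suc k) = 1 / (real (Suc k) * (exp (real (Suc k) * \<beta>) - 1))"
      unfolding er using r by (simp add: field_simps)
    ultimately have "(\<lambda>n. f (n,k)) sums (1 / (real (Suc k) * (exp (real (Suc k) * \<beta>) - 1)))"
      by simp
    then show ?thesis using fnn by (auto intro!: sums_nonneg_imp_has_sum)
  qed
  show "(\<lambda>k. 1 / (real (Suc k) * (exp (real (Suc k) * \<beta>) - 1))) sums S"
    using has_sum_SigmaD[OF 3 4] by (rule has_sum_imp_sums)
qed

section \<open>The lattice kernel and its integral comparison\<close>

text \<open>The partial fraction term of \<open>1 / (exp x - 1)\<close> at
  \<open>x = k * \<beta>\<close>, divided by \<open>k\<close>. In this form the passage to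
  \<open>4 * pi\<^sup>2 / \<beta>\<close> merely exchanges \<open>k\<close> and
  \<open>m\<close>.\<close>

definition lat :: "real \<Rightarrow> real \<Rightarrow> real \<Rightarrow> real" where
  "lat \<beta> k m = 2 * \<beta> / (k\<^sup>2 * \<beta>\<^sup>2 + 4 * pi\<^sup>2 * m\<^sup>2)"

lemma lat_dual:
  assumes "\<beta> > 0"
  shows "lat (4 * pi\<^sup>2 / \<beta>) k m = lat \<beta> m k"
\<comment> \<open>At the origin both denominators vanish and both sides are 0 by convention;
  elsewhere the fraction is expanded by \<open>\<beta>\<^sup>2 / (4 * pi\<^sup>2)\<close>.\<close>
proof (cases "k = 0 \<and> m = 0")
  case False
  define D where "D = m\<^sup>2 * \<beta>\<^sup>2 + 4 * pi\<^sup>2 * k\<^sup>2"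
  from False consider "k \<noteq> 0" | "m \<noteq> 0" by auto
  then have "D > 0" unfolding D_def
    by cases (use assms in \<open>simp_all add: add_pos_nonneg add_nonneg_pos\<close>)
  then have "2 * (P / \<beta>) / (P * D / \<beta>\<^sup>2) = 2 * \<beta> / D" if "P > 0" for P
    using assms that by (simp add: field_simps power2_eq_square)
  from this[of "4 * pi\<^sup>2"] have "2 * (4 * pi\<^sup>2 / \<beta>) / (4 * pi\<^sup>2 * D / \<beta>\<^sup>2) = 2 * \<beta> / D" by simp
  moreover have "k\<^sup>2 * (4 * pi\<^sup>2 / \<beta>)\<^sup>2 + 4 * pi\<^sup>2 * m\<^sup>2 = 4 * pi\<^sup>2 * D / \<beta>\<^sup>2"
    using assms by (simp add: D_def field_simps power2_eq_square)
  ultimately show ?thesis by (simp only: lat_def D_def)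
qed (simp add: lat_def)

lemma lat_row_sums:
  assumes "\<beta> > 0" "k > 0"
  shows "(\<lambda>m. lat \<beta> k (real (Suc m))) sums
     (1 / (k * (exp (k * \<beta>) - 1)) - 1 / (k\<^sup>2 * \<beta>) + 1 / (2 * k))"
proof -
  have "(\<lambda>m. (1/k) * (2 * (k * \<beta>) / ((k * \<beta>)\<^sup>2 + 4 * pi\<^sup>2 * (real (Suc m))\<^sup>2))) sums
     ((1/k) * (1 / (exp (k * \<beta>) - 1) - 1 / (k * \<beta>) + 1 / 2))"
    using assms by (intro sums_mult bose_partial_fractions) auto
  moreover have "(1/k) * (2 * (k * \<beta>) / ((k * \<beta>)\<^sup>2 + 4 * pi\<^sup>2 * (real (Suc m))\<^sup>2)) = lat \<beta> k (real (Suc m))" for m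
    using assms by (simp add: lat_def power_mult_distrib)
  moreover have "(1/k) * (1 / (exp (k * \<beta>) - 1) - 1 / (k * \<beta>) + 1 / 2) =
      1 / (k * (exp (k * \<beta>) - 1)) - 1 / (k\<^sup>2 * \<beta>) + 1 / (2 * k)"
    by (simp add: right_diff_distrib distrib_left power2_eq_square)
  ultimately show ?thesis by simp
qed

lemma lat_antimono:
  assumes "\<beta> > 0" "k > 0" "0 \<le> m" "m \<le> m'"
  shows "lat \<beta> k m' \<le> lat \<beta> k m"
proof -
  have "m\<^sup>2 \<le> m'\<^sup>2" using assms by (intro power_mono) auto
  then show ?thesis using assms unfolding lat_def
    by (intro divide_left_mono mult_pos_pos add_pos_nonneg add_mono mult_left_mono) auto
qed

text \<open>\<open>G\<close> is an antiderivative of \<open>lat \<beta> k\<close>, so the mean value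
  theorem turns its increment into a value of a decreasing function between \<open>m\<close> and
  \<open>m + 1\<close>.\<close>

lemma lat_integral_step:
  fixes \<beta> k m :: real
  assumes "\<beta> > 0" "k > 0" "m \<ge> 0"
  defines "G \<equiv> \<lambda>y. arctan (2 * pi * y / (k * \<beta>)) / (pi * k)"
  shows "lat \<beta> k (m + 1) \<le> G (m + 1) - G m" "G (m + 1) - G m \<le> lat \<beta> k m"
proof -
  have der: "(G has_real_derivative lat \<beta> k y) (at y)" for y
  proof -
    define A D where "A = k * \<beta>" and "D = A\<^sup>2 + (2 * pi)\<^sup>2 * y\<^sup>2"
    have A: "A > 0" and D: "D > 0"
      using assms by (auto simp: A_def D_def intro!: add_pos_nonneg)
    have eq: "1 + (2 * pi * y / A)\<^sup>2 = D / A\<^sup>2"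
      using A by (simp add: D_def field_simps power2_eq_square)
    have "(G has_real_derivative (2 * pi / A) * inverse (1 + (2 * pi * y / A)\<^sup>2) / (pi * k)) (at y)"
      unfolding G_def A_def [symmetric] using A
      by (intro DERIV_cdivide DERIV_chain2[OF DERIV_arctan, THEN DERIV_cong])
         (auto intro!: derivative_eq_intros)
    also have "(2 * pi / A) * inverse (1 + (2 * pi * y / A)\<^sup>2) / (pi * k) = 2 * (A / k) / D"
      unfolding eq using A D assms by (simp add: field_simps power2_eq_square)
    also have "\<dots> = lat \<beta> k y"
      using assms by (simp add: lat_def A_def D_def power_mult_distrib)
    finally show ?thesis .
  qed
  obtain z where z: "m < z" "z < m + 1" "G (m + 1) - G m = (m + 1 - m) * lat \<beta> k z"
    using MVT2[of m "m + 1" G "lat \<beta> k"] der by auto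
  then show "lat \<beta> k (m + 1) \<le> G (m + 1) - G m" "G (m + 1) - G m \<le> lat \<beta> k m"
    using lat_antimono[of \<beta> k z "m + 1"] lat_antimono[of \<beta> k m z] assms by auto
qed

section \<open>The inverse tangent integral\<close>

lemma arctan_ge_rational: "s \<ge> 0 \<Longrightarrow> s / (1 + s\<^sup>2) \<le> arctan s"
proof -
  assume s: "s \<ge> 0"
  have "(\<lambda>x. arctan x - x / (1 + x\<^sup>2)) 0 \<le> (\<lambda>x. arctan x - x / (1 + x\<^sup>2)) s"
  proof (rule DERIV_nonneg_imp_nondecreasing[OF s])
    fix x :: real assume "0 \<le> x" "x \<le> s"
    have p: "1 + x\<^sup>2 > 0" by (simp add: add_pos_nonneg)
    have "((\<lambda>x. arctan x - x / (1 + x\<^sup>2)) has_real_derivative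
       (inverse (1 + x\<^sup>2) - (1 * (1 + x\<^sup>2) - 2 * x * x) / ((1 + x\<^sup>2) * (1 + x\<^sup>2)))) (at x)"
      using p by (intro DERIV_diff DERIV_arctan DERIV_divide) (auto intro!: derivative_eq_intros)
    moreover have "inverse (1 + x\<^sup>2) - (1 * (1 + x\<^sup>2) - 2 * x * x) / ((1 + x\<^sup>2) * (1 + x\<^sup>2)) = 2 * x\<^sup>2 / ((1 + x\<^sup>2) * (1 + x\<^sup>2))"
    proof -
      have "w > 0 \<Longrightarrow> inverse w - (1 * w - 2 * x * x) / (w * w) = 2 * x\<^sup>2 / (w * w)" for w
        by (simp add: field_simps power2_eq_square)
      then show ?thesis using p by blast
    qed
    ultimately show "\<exists>y. ((\<lambda>x. arctan x - x / (1 + x\<^sup>2)) has_real_derivative y) (at x) \<and> 0 \<le> y"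
      using p by (intro exI conjI) (assumption, simp)
  qed
  then show ?thesis by simp
qed

text \<open>The numerator of the derivative is \<open>x / (1 + x\<^sup>2) - arctan x\<close>, whose
  sign is the previous lemma. Monotonicity is what controls the Riemann sums of
  \<open>Ti2\<close>.\<close>

lemma arctan_div_antimono:
  assumes "0 < s" "s \<le> t"
  shows "arctan t / t \<le> arctan s / s"
proof (rule DERIV_nonpos_imp_nonincreasing[OF assms(2)])
  fix x :: real assume "s \<le> x" "x \<le> t"
  then have x: "x > 0" using assms by simp
  then have "((\<lambda>x. arctan x / x) has_real_derivative ((x / (1 + x\<^sup>2) - arctan x) / (x * x))) (at x)"
    by (auto intro!: derivative_eq_intros simp: field_simps)
  moreover have "(x / (1 + x\<^sup>2) - arctan x) / (x * x) \<le> 0"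
    using arctan_ge_rational[of x] x by (intro divide_nonpos_pos) auto
  ultimately show "\<exists>y. ((\<lambda>x. arctan x / x) has_real_derivative y) (at x) \<and> y \<le> 0" by blast
qed

text \<open>The classical inverse tangent integral. The integrand gets its limit 1 at 0, where the
  quotient itself would evaluate to 0.\<close>

definition Ti2 :: "real \<Rightarrow> real" where
  "Ti2 u = integral {0..u} (\<lambda>s. if s = 0 then 1 else arctan s / s)"

lemma continuous_arctan_div: "continuous_on A (\<lambda>s::real. if s = 0 then 1 else arctan s / s)"
proof -
  have "isCont (\<lambda>s::real. if s = 0 then 1 else arctan s / s) x" for x
  proof (cases "x = 0")
    case True
    have "((\<lambda>h. (arctan (0 + h) - arctan 0) / h) \<longlongrightarrow> inverse (1 + 0\<^sup>2)) (at 0)"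
      using DERIV_arctan[of 0] by (simp only: DERIV_def)
    then have "((\<lambda>h::real. arctan h / h) \<longlongrightarrow> 1) (at 0)" by simp
    then have "((\<lambda>h::real. if h = 0 then 1 else arctan h / h) \<longlongrightarrow> 1) (at 0)"
      by (rule Lim_transform_eventually) (auto simp: eventually_at_filter)
    then show ?thesis using True by (simp add: isCont_def)
  next
    case False
    have "isCont (\<lambda>s. arctan s / s) x" using False by (intro continuous_intros) auto
    then show ?thesis
      by (rule isCont_cong[THEN iffD1, rotated])
         (use False t1_space_nhds[of x 0] in \<open>auto elim: eventually_mono\<close>)
  qed
  then show ?thesis by (simp add: continuous_at_imp_continuous_on)
qed

lemma Ti2_0 [simp]: "Ti2 0 = 0" by (simp add: Ti2_def)

lemma continuous_Ti2: "continuous_on {0..u} Ti2"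
  unfolding Ti2_def
  by (intro indefinite_integral_continuous_1 integrable_continuous_real continuous_arctan_div)

lemma Ti2_has_derivative:
  assumes "u > 0"
  shows "(Ti2 has_real_derivative arctan u / u) (at u)"
proof -
  have "(Ti2 has_real_derivative (if u = 0 then 1 else arctan u / u)) (at u within {0..u + 1})"
    unfolding Ti2_def using assms
    by (intro integral_has_real_derivative continuous_arctan_div) auto
  moreover have "at u within {0..u + 1} = at u"
    using assms by (intro at_within_interior) auto
  ultimately show ?thesis using assms by simp
qed

text \<open>The difference of both sides has derivative 0 because
  \<open>arctan x + arctan (1 / x) = pi / 2\<close>; its constant value is read off at 1.\<close>

lemma Ti2_reflection:
  assumes "u > 0"
  shows "Ti2 u - Ti2 (1 / u) = pi / 2 * ln u"
proof -
  have "\<exists>c. \<forall>x\<in>{0<..}. Ti2 x - Ti2 (1 / x) - pi / 2 * ln x = c"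
  proof (rule has_field_derivative_zero_constant)
    fix x :: real assume "x \<in> {0<..}"
    then have x: "x > 0" by simp
    have "((\<lambda>x. Ti2 (1 / x)) has_real_derivative (arctan (1 / x) / (1 / x)) * (- 1 / (x * x))) (at x)"
      by (rule DERIV_chain2[OF Ti2_has_derivative])
         (use x in \<open>auto intro!: derivative_eq_intros simp: field_simps\<close>)
    then have d: "((\<lambda>x. Ti2 x - Ti2 (1 / x) - pi / 2 * ln x) has_real_derivative
       (arctan x / x - (arctan (1 / x) / (1 / x)) * (- 1 / (x * x)) - pi / 2 * (1 / x))) (at x)"
      by (intro DERIV_diff Ti2_has_derivative DERIV_cmult DERIV_ln_divide x)
    have "arctan (1 / x) = sgn x * pi / 2 - arctan x" using x by (intro Transcendental.arctan_inverse) simp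
    also have "sgn x = 1" using x by (rule sgn_pos)
    finally have ai: "arctan (1 / x) = pi / 2 - arctan x" by (simp only: mult_1)
    have "arctan x / x - (arctan (1 / x) / (1 / x)) * (- 1 / (x * x)) - pi / 2 * (1 / x) = 0"
      unfolding ai
    proof -
      have "t / x - (p - t) / (1 / x) * (- 1 / (x * x)) - p * (1 / x) = 0" for p t
        using x by (simp add: field_simps)
      then show "arctan x / x - (pi / 2 - arctan x) / (1 / x) * (- 1 / (x * x)) - pi / 2 * (1 / x) = 0" .
    qed
    with d show "((\<lambda>x. Ti2 x - Ti2 (1 / x) - pi / 2 * ln x) has_real_derivative 0) (at x within {0<..})"
      by (metis has_field_derivative_at_within)
  qed auto
  then obtain c where c: "\<And>x. x > 0 \<Longrightarrow> Ti2 x - Ti2 (1 / x) - pi / 2 * ln x = c" by auto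
  from c[of 1] have "c = 0" by simp
  with c[OF assms] show ?thesis by simp
qed

text \<open>These are right Riemann sums with mesh \<open>u / K\<close> of a decreasing function.
  The left sums exceed them by a telescoping amount, at most \<open>u / K\<close> since the
  integrand lies between 0 and 1.\<close>

lemma Ti2_Riemann_sum:
  assumes "u > 0"
  shows "(\<lambda>K. \<Sum>k<K. arctan (u * real (Suc k) / real K) / real (Suc k)) \<longlonglongrightarrow> Ti2 u"
proof -
  define g where "g = (\<lambda>s::real. if s = 0 then 1 else arctan s / s)"
  have gmono: "g t \<le> g s" if "0 \<le> s" "s \<le> t" for s t
  proof (cases "s = 0")
    case False then show ?thesis using that arctan_div_antimono[of s t] by (auto simp: g_def)
  next
    case True then show ?thesis using that arctan_le_self[of t] by (auto simp: g_def)
  qed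
  have gpos: "g s \<ge> 0" if "s \<ge> 0" for s using that by (auto simp: g_def)
  have step: "(t - s) * g t \<le> Ti2 t - Ti2 s \<and> Ti2 t - Ti2 s \<le> (t - s) * g s" if st: "0 \<le> s" "s < t" for s t
  proof -
    have "continuous_on {s..t} Ti2"
      using continuous_Ti2[of t] by (rule continuous_on_subset) (use that in auto)
    moreover have "(Ti2 has_derivative (*) (g x)) (at x)" if "s < x" "x < t" for x
      using Ti2_has_derivative[of x] that \<open>0 \<le> s\<close> by (simp add: g_def has_field_derivative_def)
    ultimately obtain z where z: "s < z" "z < t" "Ti2 t - Ti2 s = g z * (t - s)"
      by (rule mvt[OF st(2)])
    then show ?thesis using gmono[of z t] gmono[of s z] that
      by (auto simp: mult.commute intro!: mult_left_mono)
  qed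
  define R where "R = (\<lambda>K. \<Sum>k<K. arctan (u * real (Suc k) / real K) / real (Suc k))"
  have bounds: "R K \<le> Ti2 u \<and> Ti2 u \<le> R K + u / real K" if K: "K > 0" for K
  proof -
    define p where "p = (\<lambda>k. u * real k / real K)"
    have p: "p 0 = 0" "p K = u" "0 \<le> p k" "p k < p (Suc k)" "p (Suc k) - p k = u / real K" for k
      using K assms by (auto simp: p_def field_simps)
    have R: "R K = (\<Sum>k<K. u / real K * g (p (Suc k)))"
      unfolding R_def
    proof (intro sum.cong refl)
      fix k
      have "u / real K * (X / (u * c / real K)) = X / c" if "c > 0" for X c
        using K assms that by simp
      from this[of "real (Suc k)"] K assms
      show "arctan (u * real (Suc k) / real K) / real (Suc k) = u / real K * g (p (Suc k))"
        by (simp add: p_def g_def del: of_nat_Suc)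
    qed
    have tel: "(\<Sum>k<K. Ti2 (p (Suc k)) - Ti2 (p k)) = Ti2 u"
      using sum_lessThan_telescope[of "\<lambda>k. Ti2 (p k)" K] p(1,2) by simp
    have "R K \<le> Ti2 u" unfolding R tel [symmetric]
      by (intro sum_mono) (use step[OF p(3,4)] p(5) in auto)
    moreover have "Ti2 u \<le> (\<Sum>k<K. u / real K * g (p k))" unfolding tel [symmetric]
      by (intro sum_mono) (use step[OF p(3,4)] p(5) in auto)
    moreover have "(\<Sum>k<K. u / real K * g (p k)) - R K = (\<Sum>k<K. u / real K * g (p k) - u / real K * g (p (Suc k)))"
      unfolding R by (simp add: sum_subtractf)
    moreover have "\<dots> = u / real K * g (p 0) - u / real K * g (p K)"
      by (rule sum_lessThan_telescope')
    moreover have "\<dots> \<le> u / real K"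
      using K assms gpos[of u] p by (simp add: g_def)
    ultimately show ?thesis by linarith
  qed
  have "(\<lambda>K. Ti2 u - u / real K) \<longlonglongrightarrow> Ti2 u - 0"
    by (intro tendsto_diff tendsto_const lim_const_over_n)
  moreover have "\<forall>\<^sub>F K in sequentially. R K \<le> Ti2 u \<and> Ti2 u \<le> R K + u / real K"
    using eventually_gt_at_top[of 0] by eventually_elim (rule bounds)
  then have "\<forall>\<^sub>F K in sequentially. Ti2 u - u / real K \<le> R K" "\<forall>\<^sub>F K in sequentially. R K \<le> Ti2 u"
    by (eventually_elim, simp)+
  ultimately have "R \<longlonglongrightarrow> Ti2 u"
    using tendsto_sandwich[of "\<lambda>K. Ti2 u - u / real K" R sequentially "\<lambda>_. Ti2 u"] by simp
  then show ?thesis by (simp add: R_def)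
qed

text \<open>Integral test for the row \<open>k\<close> beyond \<open>K\<close>: the arctangent is
  the integral of \<open>lat \<beta> k\<close> from \<open>K\<close> to infinity, and the one extra
  term \<open>lat \<beta> k K\<close> bounds the error.\<close>

lemma lat_tail:
  fixes \<beta> k :: real and K :: nat
  assumes "\<beta> > 0" "k > 0" "K > 0"
  defines "T \<equiv> (\<Sum>m. lat \<beta> k (real (Suc (m + K))))"
  shows "T \<le> arctan (k * \<beta> / (2 * pi * real K)) / (pi * k)"
    and "arctan (k * \<beta> / (2 * pi * real K)) / (pi * k) \<le> lat \<beta> k (real K) + T"
proof -
  define G where "G = (\<lambda>y. arctan (2 * pi * y / (k * \<beta>)) / (pi * k))"
  have summ0: "summable (\<lambda>m. lat \<beta> k (real (Suc m)))"
    using lat_row_sums[OF assms(1,2)] by (simp add: sums_iff)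
  then have summ: "summable (\<lambda>m. lat \<beta> k (real (Suc (m + K))))"
    by (subst (asm) summable_iff_shift [symmetric, of _ K]) simp
  have summ1: "summable (\<lambda>m. lat \<beta> k (real (m + K)))"
    by (subst summable_Suc_iff [symmetric]) (use summ in simp)
  have "filterlim (\<lambda>n. 2 * pi * (real (n + K)) / (k * \<beta>)) at_top sequentially"
  proof -
    have "filterlim (\<lambda>n. (2 * pi / (k * \<beta>)) * real (n + K)) at_top sequentially"
      using assms
      by (intro filterlim_tendsto_pos_mult_at_top[OF tendsto_const]
            filterlim_compose[OF filterlim_real_sequentially] filterlim_add_const_nat_at_top) auto
    then show ?thesis by simp
  qed
  then have "(\<lambda>n. G (real (n + K))) \<longlonglongrightarrow> (pi / 2) / (pi * k)"
    unfolding G_def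
    by (intro tendsto_divide tendsto_const filterlim_compose[OF tendsto_arctan_at_top]) (use assms in auto)
  then have tel: "(\<lambda>n. G (real (Suc n + K)) - G (real (n + K))) sums ((pi / 2) / (pi * k) - G (real (0 + K)))"
    by (intro telescope_sums)
  \<comment> \<open>The limit \<open>pi / 2\<close> minus the value at \<open>K\<close> is the
    arctangent of the reciprocal argument.\<close>
  have "arctan (k * \<beta> / (2 * pi * real K)) = arctan (1 / (2 * pi * real K / (k * \<beta>)))"
    by simp
  also have "\<dots> = sgn (2 * pi * real K / (k * \<beta>)) * pi / 2 - arctan (2 * pi * real K / (k * \<beta>))"
    by (rule Transcendental.arctan_inverse) (use assms in auto)
  also have "sgn (2 * pi * real K / (k * \<beta>)) = 1"
    by (rule sgn_pos) (use assms in auto)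
  finally have "(pi / 2) / (pi * k) - G (real (0 + K)) = arctan (k * \<beta> / (2 * pi * real K)) / (pi * k)"
    by (simp add: G_def diff_divide_distrib)
  with tel have tel: "(\<lambda>n. G (real (Suc n + K)) - G (real (n + K))) sums (arctan (k * \<beta> / (2 * pi * real K)) / (pi * k))"
    by simp
  have step: "lat \<beta> k (real (Suc (m + K))) \<le> G (real (Suc m + K)) - G (real (m + K))"
    "G (real (Suc m + K)) - G (real (m + K)) \<le> lat \<beta> k (real (m + K))" for m
    using lat_integral_step[OF assms(1,2), of "real (m + K)"] by (simp_all add: G_def add_ac)
  show "T \<le> arctan (k * \<beta> / (2 * pi * real K)) / (pi * k)"
    unfolding T_def by (rule sums_le[OF step(1) summable_sums[OF summ] tel])
  have "arctan (k * \<beta> / (2 * pi * real K)) / (pi * k) \<le> (\<Sum>m. lat \<beta> k (real (m + K)))"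
    by (rule sums_le[OF step(2) tel summable_sums[OF summ1]])
  also have "\<dots> = lat \<beta> k (real K) + T"
    unfolding T_def using suminf_split_head[OF summ1] by simp
  finally show "arctan (k * \<beta> / (2 * pi * real K)) / (pi * k) \<le> lat \<beta> k (real K) + T" .
qed

text \<open>By \<open>lat_tail\<close> the rows add up to a Riemann sum for \<open>Ti2\<close>. Each
  of the \<open>K\<close> rows has an error of at most \<open>c / K\<^sup>2\<close>, so the total
  error is at most \<open>c / K\<close>.\<close>

lemma lat_tail_sum_limit:
  assumes "\<beta> > 0"
  shows "(\<lambda>K. \<Sum>k<K. \<Sum>m. lat \<beta> (real (Suc k)) (real (Suc (m + K)))) \<longlonglongrightarrow> Ti2 (\<beta> / (2 * pi)) / pi"
proof -
  define u where "u = \<beta> / (2 * pi)"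
  define A where "A = (\<lambda>K. (\<Sum>k<K. arctan (u * real (Suc k) / real K) / real (Suc k)) / pi)"
  define B where "B = (\<lambda>K. \<Sum>k<K. \<Sum>m. lat \<beta> (real (Suc k)) (real (Suc (m + K))))"
  have u: "u > 0" using assms by (simp add: u_def)
  have A: "A \<longlonglongrightarrow> Ti2 u / pi"
    unfolding A_def by (intro tendsto_divide Ti2_Riemann_sum u tendsto_const) simp
  define c where "c = 2 * \<beta> / (4 * pi\<^sup>2)"
  have *: "B K \<le> A K \<and> A K - c / real K \<le> B K" if K: "K > 0" for K
  proof
    have AK: "A K = (\<Sum>k<K. arctan (real (Suc k) * \<beta> / (2 * pi * real K)) / (pi * real (Suc k)))"
      unfolding A_def sum_divide_distrib by (simp add: u_def mult_ac)
    show "B K \<le> A K" unfolding AK B_def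
      by (intro sum_mono lat_tail(1)) (use assms K in auto)
    have "A K \<le> (\<Sum>k<K. c / (real K)\<^sup>2 + (\<Sum>m. lat \<beta> (real (Suc k)) (real (Suc (m + K)))))"
      unfolding AK
    proof (intro sum_mono)
      fix k
      have "lat \<beta> (real (Suc k)) (real K) \<le> 2 * \<beta> / (4 * pi\<^sup>2 * (real K)\<^sup>2)"
        unfolding lat_def using assms K by (intro divide_left_mono) (auto intro!: mult_pos_pos add_nonneg_pos)
      also have "\<dots> = c / (real K)\<^sup>2" by (simp add: c_def)
      finally show "arctan (real (Suc k) * \<beta> / (2 * pi * real K)) / (pi * real (Suc k)) \<le>
         c / (real K)\<^sup>2 + (\<Sum>m. lat \<beta> (real (Suc k)) (real (Suc (m + K))))"
        using lat_tail(2)[of \<beta> "real (Suc k)" K] assms K by simp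
    qed
    also have "\<dots> = c / real K + B K"
      by (simp add: sum.distrib B_def power2_eq_square)
    finally show "A K - c / real K \<le> B K" by simp
  qed
  have "(\<lambda>K. A K - c / real K) \<longlonglongrightarrow> Ti2 u / pi - 0"
    by (intro tendsto_diff A lim_const_over_n)
  moreover have "\<forall>\<^sub>F K in sequentially. B K \<le> A K \<and> A K - c / real K \<le> B K"
    using eventually_gt_at_top[of 0] by eventually_elim (rule *)
  then have "\<forall>\<^sub>F K in sequentially. A K - c / real K \<le> B K" "\<forall>\<^sub>F K in sequentially. B K \<le> A K"
    by (eventually_elim, simp)+
  ultimately have "B \<longlonglongrightarrow> Ti2 u / pi"
    using tendsto_sandwich[OF _ _ _ A, of "\<lambda>K. A K - c / real K" B] by simp
  then show ?thesis by (simp add: B_def u_def)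
qed

text \<open>Cut both double sums at \<open>K\<close>: the squares \<open>k, m \<le> K\<close> agree by \<open>lat_dual\<close>, the harmonic sums
  cancel, and the tails converge to inverse tangent integrals.\<close>

lemma euler_product_ln_dual:
  assumes "\<beta> > 0"
  defines "F \<equiv> \<lambda>\<beta>. - ln (\<Prod>n. 1 - exp (- real (Suc n) * \<beta>))"
  shows "F \<beta> - F (4 * pi\<^sup>2 / \<beta>) = pi\<^sup>2 / (6 * \<beta>) - \<beta> / 24 + ln (\<beta> / (2 * pi)) / 2"
proof -
  define \<gamma> where "\<gamma> = 4 * pi\<^sup>2 / \<beta>"
  have \<gamma>: "\<gamma> > 0" using assms by (simp add: \<gamma>_def)
  define P where "P = (\<lambda>b K. \<Sum>k<K. 1 / (real (Suc k) * (exp (real (Suc k) * b) - 1)))"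
  define T where "T = (\<lambda>b K. \<Sum>k<K. \<Sum>m. lat b (real (Suc k)) (real (Suc (m + K))))"
  define Q where "Q = (\<lambda>K. \<Sum>k<K. 1 / (real (Suc k))\<^sup>2)"
  define H where "H = (\<lambda>K. \<Sum>k<K. 1 / (2 * real (Suc k)))"
  define L where "L = (\<lambda>b K. \<Sum>k<K. \<Sum>m<K. lat b (real (Suc k)) (real (Suc m)))"
  have P: "P b \<longlonglongrightarrow> F b" if "b > 0" for b
    using euler_product_ln(2)[OF that] by (simp add: sums_def P_def F_def)
  have T: "T b \<longlonglongrightarrow> Ti2 (b / (2 * pi)) / pi" if "b > 0" for b
    using lat_tail_sum_limit[OF that] by (simp add: T_def)
  have Q: "Q \<longlonglongrightarrow> pi\<^sup>2 / 6"
    using inverse_squares_sums by (simp add: Q_def sums_def add_ac)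
  have split: "P b K = 1 / b * Q K - H K + L b K + T b K" if "b > 0" for b K
  proof -
    have "1 / (real (Suc k) * (exp (real (Suc k) * b) - 1)) =
       1 / b * (1 / (real (Suc k))\<^sup>2) - 1 / (2 * real (Suc k)) + (\<Sum>m<K. lat b (real (Suc k)) (real (Suc m)))
        + (\<Sum>m. lat b (real (Suc k)) (real (Suc (m + K))))" for k
    proof -
      have s: "(\<lambda>m. lat b (real (Suc k)) (real (Suc m))) sums
        (1 / (real (Suc k) * (exp (real (Suc k) * b) - 1)) - 1 / ((real (Suc k))\<^sup>2 * b) + 1 / (2 * real (Suc k)))"
        by (rule lat_row_sums) (use that in auto)
      from suminf_split_initial_segment[OF sums_summable[OF s], of K] sums_unique[OF s]
      show ?thesis by (simp add: mult.commute del: of_nat_Suc)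
    qed
    then show ?thesis
      unfolding P_def Q_def H_def L_def T_def sum_distrib_left
      by (simp only: sum.distrib sum_subtractf)
  qed
  have LL: "L \<gamma> K = L \<beta> K" for K
    unfolding L_def \<gamma>_def lat_dual[OF assms(1)] by (rule sum.swap)
  have "(\<lambda>K. P \<beta> K - P \<gamma> K) \<longlonglongrightarrow> F \<beta> - F \<gamma>"
    by (intro tendsto_diff P assms \<gamma>)
  moreover have "(\<lambda>K. P \<beta> K - P \<gamma> K) = (\<lambda>K. (1 / \<beta> - 1 / \<gamma>) * Q K + (T \<beta> K - T \<gamma> K))"
    by (auto simp: split assms \<gamma> LL left_diff_distrib)
  moreover have "(\<lambda>K. (1 / \<beta> - 1 / \<gamma>) * Q K + (T \<beta> K - T \<gamma> K)) \<longlonglongrightarrow>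
     (1 / \<beta> - 1 / \<gamma>) * (pi\<^sup>2 / 6) + (Ti2 (\<beta> / (2 * pi)) / pi - Ti2 (\<gamma> / (2 * pi)) / pi)"
    by (intro tendsto_add tendsto_diff tendsto_mult tendsto_const Q T assms \<gamma>)
  ultimately have "F \<beta> - F \<gamma> = (1 / \<beta> - 1 / \<gamma>) * (pi\<^sup>2 / 6) + (Ti2 (\<beta> / (2 * pi)) / pi - Ti2 (\<gamma> / (2 * pi)) / pi)"
    by (metis LIMSEQ_unique)
  \<comment> \<open>The two arguments are reciprocal, so the reflection formula applies; this
    logarithm is the origin of the square root in \<open>eta_modular\<close>.\<close>
  moreover have "Ti2 (\<beta> / (2 * pi)) / pi - Ti2 (\<gamma> / (2 * pi)) / pi = ln (\<beta> / (2 * pi)) / 2"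
  proof -
    have "\<gamma> / (2 * pi) = 1 / (\<beta> / (2 * pi))"
      by (simp add: \<gamma>_def power2_eq_square)
    then show ?thesis
      using Ti2_reflection[of "\<beta> / (2 * pi)"] assms by (simp add: diff_divide_distrib [symmetric])
  qed
  moreover have "(1 / \<beta> - 1 / \<gamma>) * (pi\<^sup>2 / 6) = pi\<^sup>2 / (6 * \<beta>) - \<beta> / 24"
    by (simp add: \<gamma>_def left_diff_distrib)
  ultimately show ?thesis by (simp only: \<gamma>_def)
qed

section \<open>The transformation law of \<open>eta\<close>\<close>

lemma eta_pos: "\<beta> > 0 \<Longrightarrow> eta \<beta> > 0"
  unfolding eta_def using euler_product_ln(1) by (intro mult_pos_pos) auto

theorem eta_modular:
  assumes "\<beta> > 0"
  shows "eta (4 * pi\<^sup>2 / \<beta>) = sqrt (\<beta> / (2 * pi)) * eta \<beta>"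
proof -
  define F where "F = (\<lambda>\<beta>. - ln (\<Prod>n. 1 - exp (- real (Suc n) * \<beta>)))"
  have eta: "eta b = exp (- b / 24 - F b)" if "b > 0" for b
  proof -
    have "exp (- b / 24 - F b) = exp (- b / 24) * exp (- F b)" by (simp flip: exp_add)
    also have "exp (- F b) = (\<Prod>n. 1 - exp (- real (Suc n) * b))"
      using euler_product_ln(1)[OF that] by (simp only: F_def minus_minus exp_ln)
    finally show ?thesis by (simp only: eta_def)
  qed
  have d: "4 * pi\<^sup>2 / \<beta> > 0" using assms by simp
  have "sqrt (\<beta> / (2 * pi)) = exp (ln (\<beta> / (2 * pi)) / 2)"
    using assms by (subst ln_sqrt [symmetric]) auto
  \<comment> \<open>The prefactors \<open>exp (- \<beta> / 24)\<close> absorb exactly the terms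
    \<open>pi\<^sup>2 / (6 * \<beta>)\<close> and \<open>\<beta> / 24\<close> of
    \<open>euler_product_ln_dual\<close>.\<close>
  moreover have "- (4 * pi\<^sup>2 / \<beta>) / 24 - F (4 * pi\<^sup>2 / \<beta>) = ln (\<beta> / (2 * pi)) / 2 + (- \<beta> / 24 - F \<beta>)"
    using euler_product_ln_dual[OF assms] by (simp add: F_def)
  ultimately show ?thesis
    by (simp only: eta[OF d] eta[OF assms] exp_add)
qed

subsection \<open>Dynamics of the algorithm\<close>

lemma gap_mono:
  fixes r x y :: real
  assumes "0 \<le> r" "0 < x" "x < y"
  shows "x - r / x < y - r / y"
proof -
  have "r / y \<le> r / x" using assms by (intro divide_left_mono) auto
  then show ?thesis using assms(3) by simp
qed

text \<open>The second branch of \<open>phi \<alpha> a\<close> is the larger root of \<open>b * charge \<alpha> a b = 0\<close> as a quadratic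
  in \<open>b\<close>; the algorithm conserves this quantity (lemma \<open>charge_step\<close> below).\<close>

definition charge :: "real \<Rightarrow> real \<Rightarrow> real \<Rightarrow> real" where
  "charge \<alpha> a b = b - \<alpha> * (4 * pi - a) - (1 - \<alpha>) * (4 * pi\<^sup>2) / b"

text \<open>The condition \<open>phi \<alpha> a < b\<close> freed of maximum and square root: one
  inequality for each branch of \<open>phi\<close>.\<close>

definition admissible :: "real \<Rightarrow> real \<Rightarrow> real \<Rightarrow> bool" where
  "admissible \<alpha> a b \<longleftrightarrow> 2 * pi < a \<and> 0 < b \<and> 4 * pi\<^sup>2 / b < a \<and> 0 < charge \<alpha> a b"

lemma phi_less_imp_admissible:
  assumes "0 < \<alpha>" "\<alpha> \<le> 1" "2 * pi < a" "phi \<alpha> a < b"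
  shows "admissible \<alpha> a b"
proof -
  have "a > 0" using assms(3) pi_gt_zero by linarith
  define p where "p = \<alpha> * (4 * pi - a)"
  define r where "r = 4 * pi\<^sup>2 * (1 - \<alpha>)"
  define s where "s = sqrt (p\<^sup>2 + 4 * r)"
  have r: "r \<ge> 0" using assms by (simp add: r_def)
  have b: "4 * pi\<^sup>2 / a < b" "(p + s) / 2 < b"
    using assms(4) by (simp_all add: phi_def p_def s_def r_def power_mult_distrib mult_ac)
  have "b > 0" using b(1) \<open>a > 0\<close> by (smt (verit) divide_pos_pos pi_gt_zero zero_less_power)
  have s: "s\<^sup>2 = p\<^sup>2 + 4 * r" "s \<ge> 0" using r by (simp_all add: s_def)
  have "s\<^sup>2 < (2 * b - p)\<^sup>2" using b(2) s by (intro power_strict_mono) auto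
  then have "0 < b * b - p * b - r" using s(1) by (simp add: power2_eq_square algebra_simps)
  then have "0 < (b * b - p * b - r) / b" using \<open>b > 0\<close> by simp
  also have "\<dots> = charge \<alpha> a b"
    using \<open>b > 0\<close> by (simp add: charge_def p_def r_def field_simps)
  finally show ?thesis
    using assms b \<open>a > 0\<close> \<open>b > 0\<close> by (simp add: admissible_def field_simps)
qed

text \<open>By \<open>gap_mono\<close> the left side of the equation is strictly increasing in
  \<open>t\<close>, so the definite description picks out any positive solution.\<close>

lemma t_sol_eqI:
  assumes "\<alpha> \<le> 1" "t > 0" "t - (1 - \<alpha>) * (4 * pi\<^sup>2) / t = \<alpha> * a + bt - 4 * pi\<^sup>2 / bt"
  shows "t_sol \<alpha> a bt = t"
  unfolding t_sol_def mult.assoc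
proof (rule the_equality)
  fix u assume u: "u > 0 \<and> \<alpha> * a + bt - 4 * pi\<^sup>2 / bt + (1 - \<alpha>) * (4 * pi\<^sup>2) / u - u = 0"
  then have "u - (1 - \<alpha>) * (4 * pi\<^sup>2) / u = t - (1 - \<alpha>) * (4 * pi\<^sup>2) / t"
    using assms(3) by linarith
  moreover have "(1 - \<alpha>) * (4 * pi\<^sup>2) \<ge> 0" using assms by simp
  ultimately show "u = t"
    using gap_mono[of "(1 - \<alpha>) * (4 * pi\<^sup>2)" u t] gap_mono[of "(1 - \<alpha>) * (4 * pi\<^sup>2)" t u] u assms(2)
    by (cases u t rule: linorder_cases) auto
next
  show "t > 0 \<and> \<alpha> * a + bt - 4 * pi\<^sup>2 / bt + (1 - \<alpha>) * (4 * pi\<^sup>2) / t - t = 0"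
    using assms(2,3) by linarith
qed

section \<open>One step of the algorithm\<close>

text \<open>An unfinished point with its coordinates ordered so that \<open>b\<close> is the one to
  be inverted; both branches of \<open>alg_step\<close> are instances.\<close>

locale step =
  fixes \<alpha> a b :: real
  assumes \<alpha>: "0 < \<alpha>" "\<alpha> \<le> 1" and adm: "admissible \<alpha> a b" and b_le: "b \<le> 2 * pi"
begin

abbreviation "bt \<equiv> tilde_b \<alpha> b a"
abbreviation "t \<equiv> t_sol \<alpha> a bt"

lemma a_gt: "2 * pi < a" and a_pos: "0 < a" and b_pos: "0 < b"
  using adm pi_gt_zero unfolding admissible_def by linarith+

text \<open>The replacement for \<open>b = 2 * pi\<close> is chosen so that its dual
  \<open>x\<close> lies strictly between \<open>2 * pi\<close> and \<open>a\<close>. The lower bound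
  on \<open>bt\<close> is \<open>(x - 2 * pi)\<^sup>2 > 0\<close> in disguise.\<close>

lemma at_two_pi:
  assumes "b = 2 * pi"
  shows "4 * pi\<^sup>2 / bt = 2 * pi + \<alpha> * (a - 2 * pi) / 2"
    and "4 * pi - 4 * pi\<^sup>2 / bt < bt" and "0 < bt" and "bt < 2 * pi" and "4 * pi\<^sup>2 / bt < a"
proof -
  define x where "x = 2 * pi + \<alpha> * (a - 2 * pi) / 2"
  have d: "\<alpha> * (a - 2 * pi) > 0" using a_gt \<alpha> by simp
  then have x: "x > 2 * pi" "x > 0" using pi_gt_zero by (simp_all add: x_def add_pos_pos)
  have bt: "bt = 4 * pi\<^sup>2 / x"
    using assms x by (simp add: tilde_b_def x_def field_simps)
  then have xbt: "4 * pi\<^sup>2 / bt = x" using x by simp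
  show "4 * pi\<^sup>2 / bt = 2 * pi + \<alpha> * (a - 2 * pi) / 2" unfolding xbt by (simp add: x_def)
  have "(x - 2 * pi) * (x - 2 * pi) > 0" using x by simp
  then have "(4 * pi - x) * x < 4 * pi\<^sup>2" by (simp add: algebra_simps power2_eq_square)
  then show "4 * pi - 4 * pi\<^sup>2 / bt < bt" unfolding xbt using x by (simp add: bt pos_less_divide_eq)
  show "0 < bt" using x by (simp add: bt)
  show "bt < 2 * pi"
    unfolding bt using x by (simp add: pos_divide_less_eq power2_eq_square)
  have "\<alpha> * (a - 2 * pi) \<le> 1 * (a - 2 * pi)" using \<alpha> a_gt by (intro mult_right_mono) auto
  moreover have "2 * pi + z / 2 < a" if "z \<le> 1 * (a - 2 * pi)" for z
    using that a_gt by (simp add: field_simps)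
  ultimately show "4 * pi\<^sup>2 / bt < a" unfolding xbt x_def by blast
qed

lemma below_two_pi: "b < 2 * pi \<Longrightarrow> bt = b"
  by (simp add: tilde_b_def)

lemma bt: "0 < bt" "bt \<le> b" "bt < 2 * pi" "4 * pi\<^sup>2 / bt < a" "2 * pi < 4 * pi\<^sup>2 / bt"
proof -
  show bt: "0 < bt" "bt \<le> b" "bt < 2 * pi" "4 * pi\<^sup>2 / bt < a"
    using at_two_pi below_two_pi adm b_le by (cases "b = 2 * pi"; force simp: admissible_def)+
  show "2 * pi < 4 * pi\<^sup>2 / bt"
    using bt by (simp add: pos_less_divide_eq power2_eq_square)
qed

text \<open>Only the replacement at \<open>2 * pi\<close> needs an argument, as it lowers the
  charge; by \<open>at_two_pi\<close> more than \<open>\<alpha> * d / 2\<close> remains.\<close>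

lemma charge_bt_pos: "0 < charge \<alpha> a bt"
proof (cases "b = 2 * pi")
  case False
  then show ?thesis using below_two_pi adm b_le by (simp add: admissible_def)
next
  case True
  define d where "d = \<alpha> * (a - 2 * pi)"
  have "d > 0" "\<alpha> * d > 0" using a_gt \<alpha> by (simp_all add: d_def)
  have "charge \<alpha> a bt = bt - \<alpha> * (4 * pi - a) - (1 - \<alpha>) * (4 * pi\<^sup>2 / bt)"
    by (simp add: charge_def)
  also have "\<dots> = bt - 2 * pi + d / 2 + \<alpha> * d / 2"
    unfolding at_two_pi(1)[OF True] by (simp add: d_def field_simps)
  also have "bt > 2 * pi - d / 2"
    using at_two_pi(2)[OF True] unfolding at_two_pi(1)[OF True] by (simp add: d_def)
  then have "bt - 2 * pi + d / 2 + \<alpha> * d / 2 > 0" using \<open>\<alpha> * d > 0\<close> by linarith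
  finally show ?thesis .
qed

lemma t_props: "0 < t" "t - (1 - \<alpha>) * (4 * pi\<^sup>2) / t = \<alpha> * a + bt - 4 * pi\<^sup>2 / bt"
proof -
  define B where "B = \<alpha> * a + bt - 4 * pi\<^sup>2 / bt"
  define r where "r = (1 - \<alpha>) * (4 * pi\<^sup>2)"
  define s where "s = sqrt (B\<^sup>2 + 4 * r)"
  define u where "u = (B + s) / 2"
  have r: "r \<ge> 0" using \<alpha> by (simp add: r_def)
  have s: "s\<^sup>2 = B\<^sup>2 + 4 * r" using r by (simp add: s_def)
  have u: "u > 0"
  \<comment> \<open>\<open>u\<close> is the larger root of \<open>u\<^sup>2 - B * u - r\<close>. For
    \<alpha> < 1 the product of the roots is negative; for \<alpha> = 1 the root is
    \<open>B\<close>, positive because \<open>4 * pi\<^sup>2 / bt < a\<close>.\<close>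
  proof (cases "\<alpha> = 1")
    case True
    then have "B > 0" using bt by (simp add: B_def)
    moreover have "s \<ge> 0" using r by (simp add: s_def)
    ultimately show ?thesis by (simp add: u_def)
  next
    case False
    then have "r > 0" using \<alpha> by (simp add: r_def)
    then have "sqrt (B\<^sup>2) < s" unfolding s_def by (intro real_sqrt_less_mono) simp
    then show ?thesis by (simp add: u_def)
  qed
  have "u * u = B * u + r" using s by (simp add: u_def field_simps power2_eq_square)
  then have "u = B + r / u" using u by (simp add: field_simps)
  then have eq: "u - r / u = B" by simp
  have "t = u"
    using \<alpha> u eq by (intro t_sol_eqI) (auto simp: B_def r_def)
  then show "0 < t" "t - (1 - \<alpha>) * (4 * pi\<^sup>2) / t = \<alpha> * a + bt - 4 * pi\<^sup>2 / bt"
    using u eq by (simp_all add: B_def r_def)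
qed

lemma gap_cancel: "x - (1 - \<alpha>) * (4 * pi\<^sup>2) / x < t - (1 - \<alpha>) * (4 * pi\<^sup>2) / t \<Longrightarrow> 0 < x \<Longrightarrow> x < t"
  using gap_mono[of "(1 - \<alpha>) * (4 * pi\<^sup>2)" t x] t_props \<alpha> by (cases x t rule: linorder_cases) auto

text \<open>Needed to lower \<open>a\<close> to \<open>4 * pi\<^sup>2 / t\<close> in the heavy part.
  After insertion of \<open>4 * pi\<^sup>2 / a\<close> into the equation for \<open>t\<close>, the
  claim is \<open>gap_mono\<close> applied to \<open>4 * pi\<^sup>2 / bt < a\<close>.\<close>

lemma dual_t_le: "4 * pi\<^sup>2 / t \<le> a"
proof -
  define y where "y = 4 * pi\<^sup>2 / a"
  have y: "y > 0" "4 * pi\<^sup>2 / y = a" using a_pos by (simp_all add: y_def)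
  have "4 * pi\<^sup>2 / bt - bt < a - 4 * pi\<^sup>2 / a"
    using gap_mono[of "4 * pi\<^sup>2" "4 * pi\<^sup>2 / bt" a] bt by simp
  then have "y - (1 - \<alpha>) * a < \<alpha> * a + bt - 4 * pi\<^sup>2 / bt" by (simp add: y_def algebra_simps)
  moreover have "(1 - \<alpha>) * (4 * pi\<^sup>2) / y = (1 - \<alpha>) * a"
    unfolding y(2) [symmetric] by simp
  ultimately have "y < t" using t_props y by (intro gap_cancel) auto
  then have "4 * pi\<^sup>2 / t \<le> 4 * pi\<^sup>2 / y" using y by (intro divide_left_mono) auto
  then show ?thesis using y by simp
qed

lemma bt_less_t: "bt < t"
proof -
  have "\<alpha> * (4 * pi\<^sup>2 / bt) < \<alpha> * a" using bt \<alpha> by (intro mult_strict_left_mono) auto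
  then have "bt - (1 - \<alpha>) * (4 * pi\<^sup>2) / bt < t - (1 - \<alpha>) * (4 * pi\<^sup>2) / t"
    unfolding t_props(2) by (simp add: left_diff_distrib diff_divide_distrib)
  then show ?thesis using bt by (intro gap_cancel) auto
qed

lemma charge_step: "charge \<alpha> (4 * pi\<^sup>2 / bt) t = charge \<alpha> a bt"
proof -
  have "charge \<alpha> (4 * pi\<^sup>2 / bt) t = (t - (1 - \<alpha>) * (4 * pi\<^sup>2) / t) - \<alpha> * (4 * pi - 4 * pi\<^sup>2 / bt)"
    by (simp add: charge_def)
  also have "\<dots> = charge \<alpha> a bt"
    unfolding t_props(2) charge_def using bt by (simp add: field_simps)
  finally show ?thesis .
qed

lemma admissible_step: "admissible \<alpha> (4 * pi\<^sup>2 / bt) t"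
  unfolding admissible_def charge_step
  using charge_bt_pos bt t_props(1) bt_less_t
  by (auto simp: divide_less_cancel intro!: divide_strict_left_mono simp: field_simps)

text \<open>The exceptional replacement leads straight to a stopping point, so the termination
  argument may assume \<open>bt = b\<close>.\<close>

lemma stops_after_two_pi:
  assumes "b = 2 * pi"
  shows "2 * pi < t"
proof (rule gap_cancel)
  define d where "d = \<alpha> * (a - 2 * pi)"
  have "\<alpha> * a + bt - 4 * pi\<^sup>2 / bt = d + 2 * \<alpha> * pi + bt - (2 * pi + d / 2)"
    unfolding at_two_pi(1)[OF assms] by (simp add: d_def algebra_simps)
  moreover have "bt > 2 * pi - d / 2"
    using at_two_pi(2)[OF assms] unfolding at_two_pi(1)[OF assms] by (simp add: d_def)
  ultimately have "\<alpha> * a + bt - 4 * pi\<^sup>2 / bt > 2 * \<alpha> * pi" by linarith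
  moreover have "(1 - \<alpha>) * (4 * pi\<^sup>2) / (2 * pi) = 2 * pi - 2 * \<alpha> * pi"
    by (simp add: power2_eq_square field_simps)
  ultimately show "2 * pi - (1 - \<alpha>) * (4 * pi\<^sup>2) / (2 * pi) < t - (1 - \<alpha>) * (4 * pi\<^sup>2) / t"
    unfolding t_props(2) by linarith
qed simp

end

text \<open>A step lowers the larger coordinate \<open>a\<close> by \<open>a - 4\<pi>\<^sup>2/b\<close>. Since \<open>charge\<close> is conserved, \<open>b\<close> times
  this decrement is a fixed concave quadratic in \<open>b\<close>, hence bounded below on the interval up
  to \<open>2\<pi>\<close> by its values at the ends.\<close>

lemma decrement_lower_bound:
  fixes \<alpha> g b b' m :: real
  defines "Q \<equiv> \<lambda>b. (g + 4 * pi * \<alpha>) * b - b\<^sup>2 + (1 - 2 * \<alpha>) * (4 * pi\<^sup>2)"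
  assumes "0 < b" "b \<le> b'" "b' \<le> 2 * pi" "m \<le> Q b" "m \<le> 2 * pi * g"
  shows "m \<le> Q b'"
proof (cases "b = 2 * pi")
  case True then show ?thesis using assms by (metis order_antisym)
next
  case False
  \<comment> \<open>The position of \<open>b'\<close> between \<open>b\<close> and
    \<open>2 * pi\<close>; the quadratic exceeds its chord there by
    \<open>l * (1 - l) * (2 * pi - b)\<^sup>2\<close>.\<close>
  define l where "l = (b' - b) / (2 * pi - b)"
  have D: "2 * pi - b > 0" using assms False by linarith
  have l: "0 \<le> l" "l \<le> 1" using assms D by (simp_all add: l_def pos_divide_le_eq)
  have lb: "l * (2 * pi - b) = b' - b" using D by (simp add: l_def)
  have Q2: "Q (2 * pi) = 2 * pi * g" by (simp add: Q_def power2_eq_square algebra_simps)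
  have b': "b' = b + l * (2 * pi - b)" using lb by simp
  have "Q b' - ((1 - l) * Q b + l * Q (2 * pi)) = l * (1 - l) * (2 * pi - b)\<^sup>2"
    unfolding b' Q_def by (simp add: power2_eq_square algebra_simps)
  moreover have "\<dots> \<ge> 0" using l by simp
  moreover have "(1 - l) * Q b + l * Q (2 * pi) \<ge> (1 - l) * m + l * m"
    using l assms Q2 by (intro add_mono mult_left_mono) auto
  ultimately show ?thesis by (simp add: algebra_simps)
qed

lemma decrement_eq:
  assumes "0 < b"
  shows "\<alpha> * b * (a - 4 * pi\<^sup>2 / b) = (charge \<alpha> a b + 4 * pi * \<alpha>) * b - b\<^sup>2 + (1 - 2 * \<alpha>) * (4 * pi\<^sup>2)"
proof -
  have "charge \<alpha> a b * b = b * b - \<alpha> * (4 * pi - a) * b - (1 - \<alpha>) * (4 * pi\<^sup>2)"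
    using assms by (simp add: charge_def field_simps)
  then show ?thesis using assms by (simp add: field_simps power2_eq_square)
qed


section \<open>The invariant region and termination\<close>

definition region :: "real \<Rightarrow> (real \<times> real) set" where
  "region \<alpha> = {p. admissible \<alpha> (fst p) (snd p) \<or> admissible \<alpha> (snd p) (fst p)}"

lemma domD_subset_region:
  assumes "0 < \<alpha>" "\<alpha> \<le> 1"
  shows "domD \<alpha> \<subseteq> region \<alpha>"
  using phi_less_imp_admissible[OF assms] by (auto simp: domD_def region_def)

lemma region_pos: "p \<in> region \<alpha> \<Longrightarrow> 0 < fst p \<and> 0 < snd p"
  using pi_gt_zero unfolding region_def admissible_def mem_Collect_eq by linarith

lemma alg_step_cases:
  assumes "0 < \<alpha>" "\<alpha> \<le> 1" "p \<in> region \<alpha>" "\<not> alg_stop p"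
  obtains a b where "step \<alpha> a b" "p = (a, b)"
      "alg_step \<alpha> p = (t_sol \<alpha> a (tilde_b \<alpha> b a), 4 * pi\<^sup>2 / tilde_b \<alpha> b a)"
  | a b where "step \<alpha> a b" "p = (b, a)"
      "alg_step \<alpha> p = (4 * pi\<^sup>2 / tilde_b \<alpha> b a, t_sol \<alpha> a (tilde_b \<alpha> b a))"
proof (cases "fst p \<le> 2 * pi")
  case True
  then have "step \<alpha> (snd p) (fst p)"
    using assms by (auto simp: step_def region_def admissible_def)
  then show ?thesis using True
    by (intro that(2)) (auto simp: alg_step_def Let_def)
next
  case False
  then have "step \<alpha> (fst p) (snd p)"
    using assms by (auto simp: step_def region_def admissible_def alg_stop_def)
  then show ?thesis using False
    by (intro that(1)) (auto simp: alg_step_def Let_def)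
qed

lemma alg_step_region:
  assumes "0 < \<alpha>" "\<alpha> \<le> 1" "p \<in> region \<alpha>" "\<not> alg_stop p"
  shows "alg_step \<alpha> p \<in> region \<alpha>"
  using assms by (rule alg_step_cases) (auto simp: region_def step.admissible_step)

text \<open>\<open>m\<close> bounds the quadratic of \<open>decrement_lower_bound\<close> at the
  current \<open>b\<close> and at \<open>2 * pi\<close>. As \<open>b \<le> 2 * pi\<close> before a
  stop, \<open>a\<close> drops by at least \<open>m / (2 * pi * \<alpha>)\<close> per step, and
  \<open>k\<close> counts how many such drops fit above \<open>2 * pi\<close>.\<close>

lemma alg_terminates_aux:
  assumes "0 < \<alpha>" "\<alpha> \<le> 1" "0 < m"
    and "admissible \<alpha> a b" "p = (a, b) \<or> p = (b, a)"
    and "m \<le> \<alpha> * b * (a - 4 * pi\<^sup>2 / b)" "m \<le> 2 * pi * charge \<alpha> a b"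
    and "a - 2 * pi \<le> real k * (m / (2 * pi * \<alpha>))"
  shows "\<exists>j. alg_stop ((alg_step \<alpha> ^^ j) p)"
  using assms(4-)
proof (induction k arbitrary: a b p)
  case 0
  then show ?case by (simp add: admissible_def)
next
  case (Suc k)
  note prems = Suc.prems
  show ?case
  proof (cases "alg_stop p")
    case True
    then show ?thesis by (intro exI[of _ 0]) simp
  next
    case False
    have "b \<le> 2 * pi" using False prems by (auto simp: alg_stop_def admissible_def)
    then interpret step \<alpha> a b using assms prems by (simp add: step_def)
    have p': "alg_step \<alpha> p = (4 * pi\<^sup>2 / bt, t) \<or> alg_step \<alpha> p = (t, 4 * pi\<^sup>2 / bt)"
      using prems(2) a_gt b_le by (auto simp: alg_step_def Let_def)
    show ?thesis
    proof (cases "2 * pi < t")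
      case True
      then have "alg_stop (alg_step \<alpha> p)" using p' bt(5) by (auto simp: alg_stop_def)
      then show ?thesis by (intro exI[of _ 1]) simp
    next
      case t: False
      then have "b < 2 * pi" using stops_after_two_pi b_le by fastforce
      then have bt_eq: "bt = b" by (rule below_two_pi)
      have g: "charge \<alpha> (4 * pi\<^sup>2 / bt) t = charge \<alpha> a b"
        using charge_step bt_eq by simp
      have "\<exists>j. alg_stop ((alg_step \<alpha> ^^ j) (alg_step \<alpha> p))"
      proof (rule Suc.IH[OF admissible_step p'])
        \<comment> \<open>The smaller coordinate moves from \<open>b\<close> up to
          \<open>t \<le> 2 * pi\<close> at constant charge, so the same quadratic is evaluated
          further right.\<close>
        show "m \<le> \<alpha> * t * (4 * pi\<^sup>2 / bt - 4 * pi\<^sup>2 / t)"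
          unfolding decrement_eq[OF t_props(1)] g
          by (rule decrement_lower_bound[of b])
             (use prems b_pos bt_less_t bt_eq t decrement_eq[OF b_pos, of \<alpha> a] in auto)
        show "m \<le> 2 * pi * charge \<alpha> (4 * pi\<^sup>2 / bt) t"
          unfolding g by (rule prems)
        have d: "a - 4 * pi\<^sup>2 / b > 0" using adm by (simp add: admissible_def)
        have "m \<le> \<alpha> * b * (a - 4 * pi\<^sup>2 / b)" by (rule prems)
        also have "\<dots> \<le> \<alpha> * (2 * pi) * (a - 4 * pi\<^sup>2 / b)"
          using d b_le \<alpha> by (intro mult_right_mono mult_left_mono) auto
        finally have "m / (2 * pi * \<alpha>) \<le> a - 4 * pi\<^sup>2 / b"
          using \<alpha> by (simp add: pos_divide_le_eq mult_ac)
        then show "4 * pi\<^sup>2 / bt - 2 * pi \<le> real k * (m / (2 * pi * \<alpha>))"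
          using prems(5) unfolding bt_eq of_nat_Suc distrib_right by linarith
      qed
      then obtain j where "alg_stop ((alg_step \<alpha> ^^ j) (alg_step \<alpha> p))" ..
      then have "alg_stop ((alg_step \<alpha> ^^ Suc j) p)" by (simp add: funpow_swap1)
      then show ?thesis ..
    qed
  qed
qed

lemma alg_terminates:
  assumes "0 < \<alpha>" "\<alpha> \<le> 1" "p \<in> region \<alpha>"
  shows "\<exists>j. alg_stop ((alg_step \<alpha> ^^ j) p)"
proof -
  obtain a b where ab: "admissible \<alpha> a b" "p = (a, b) \<or> p = (b, a)"
    using assms(3) unfolding region_def by (cases p) auto
  define m where "m = min (\<alpha> * b * (a - 4 * pi\<^sup>2 / b)) (2 * pi * charge \<alpha> a b)"
  have m: "m > 0" using ab assms by (simp add: m_def admissible_def)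
  obtain k :: nat where "(a - 2 * pi) / (m / (2 * pi * \<alpha>)) \<le> real k"
    using real_arch_simple by blast
  then have "a - 2 * pi \<le> real k * (m / (2 * pi * \<alpha>))"
    using m assms by (subst (asm) pos_divide_le_eq) auto
  then show ?thesis
    using alg_terminates_aux[OF assms(1,2) m ab, of k] by (simp add: m_def)
qed

subsection \<open>Light and heavy parts of the partition function\<close>

definition weight_factor :: "real \<Rightarrow> real \<Rightarrow> real" where
  "weight_factor h x = (if h = 0 then 1 - exp (- x) else exp (- h * x))"

definition term_red :: "(real \<times> real \<Rightarrow> nat) \<Rightarrow> real \<Rightarrow> real \<Rightarrow> real \<times> real \<Rightarrow> real" where
  "term_red n x y p = real (n p) * weight_factor (fst p) x * weight_factor (snd p) y"

text \<open>The exponential of \<open>EVir\<close> at positive arguments; the factors common to all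
  characters cancel, leaving a sum of \<open>term_red\<close>.\<close>

definition Zred :: "real \<Rightarrow> (real \<times> real \<Rightarrow> nat) \<Rightarrow> real \<Rightarrow> real \<Rightarrow> real" where
  "Zred c n x y = exp (- ((c - 1) / 24) * (x + y)) * ZVir c n x y"

lemma chi_weight_factor: "chi c h x = exp ((c - 1) / 24 * x) / eta x * weight_factor h x"
  by (simp add: chi_def weight_factor_def)

lemma weight_factor_nonneg: "x > 0 \<Longrightarrow> weight_factor h x \<ge> 0"
  by (simp add: weight_factor_def)

lemma term_red_nonneg: "x > 0 \<Longrightarrow> y > 0 \<Longrightarrow> term_red n x y p \<ge> 0"
  by (simp add: term_red_def weight_factor_nonneg)

locale cft =
  fixes c :: real and n :: "real \<times> real \<Rightarrow> nat"
  assumes c: "1 < c" and cft: "is_CFT c n"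
begin

lemma
  assumes "x > 0" "y > 0"
  shows term_red_summable: "term_red n x y summable_on {p. n p \<noteq> 0}"
    and Zred_eq_infsum: "Zred c n x y = infsum (term_red n x y) {p. n p \<noteq> 0}"
proof -
  define K where "K = exp ((c - 1) / 24 * x) / eta x * (exp ((c - 1) / 24 * y) / eta y)"
  have eta: "eta x > 0" "eta y > 0" using assms by (simp_all add: eta_pos)
  then have K: "K > 0" by (simp add: K_def)
  have eq: "(\<lambda>p. real (n p) * chi c (fst p) x * chi c (snd p) y) = (\<lambda>p. K * term_red n x y p)"
    by (simp add: chi_weight_factor K_def term_red_def mult_ac)
  have "(\<lambda>p. real (n p) * chi c (fst p) x * chi c (snd p) y) summable_on {p. n p \<noteq> 0}"
    using cft assms unfolding is_CFT_def by blast
  then show *: "term_red n x y summable_on {p. n p \<noteq> 0}"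
    unfolding eq using K by (subst (asm) summable_on_cmult_right') auto
  have "Zpart c n x y = K * infsum (term_red n x y) {p. n p \<noteq> 0}"
    unfolding Zpart_def eq using K by (intro infsum_cmult_right) (use * in auto)
  moreover have "exp (- ((c - 1) / 24) * (x + y)) * (K * X * eta x * eta y) = X" for X
  proof -
    have "K * X * eta x * eta y = exp ((c - 1) / 24 * x) * exp ((c - 1) / 24 * y) * X"
      using eta by (simp add: K_def)
    also have "exp ((c - 1) / 24 * x) * exp ((c - 1) / 24 * y) = exp ((c - 1) / 24 * (x + y))"
      by (simp add: exp_add [symmetric] distrib_left)
    finally have e: "K * X * eta x * eta y = exp ((c - 1) / 24 * (x + y)) * X" .
    show ?thesis unfolding e by (simp add: mult.assoc [symmetric] exp_add [symmetric])
  qed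
  ultimately show "Zred c n x y = infsum (term_red n x y) {p. n p \<noteq> 0}"
    by (simp add: Zred_def ZVir_def)
qed

text \<open>Arbitrary index sets are allowed because the sets of currents in
  \<open>Zred_split\<close> may contain weights of multiplicity 0.\<close>

lemma term_red_summable_on:
  assumes "x > 0" "y > 0"
  shows "term_red n x y summable_on A"
proof -
  have "term_red n x y summable_on (A \<inter> {p. n p \<noteq> 0})"
    by (rule summable_on_subset_banach[OF term_red_summable[OF assms]]) auto
  then show ?thesis
    by (rule summable_on_cong_neutral[THEN iffD1, rotated -1]) (auto simp: term_red_def)
qed

lemma ZH_eq_infsum:
  assumes "0 < \<alpha>"
  shows "ZH_tilde c n \<alpha> x y = infsum (term_red n x y)
      {p. n p \<noteq> 0 \<and> fst p \<ge> \<alpha> * (c - 1) / 24 \<and> snd p \<ge> \<alpha> * (c - 1) / 24}"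
proof -
  have "\<alpha> * (c - 1) / 24 > 0" using assms c by simp
  then show ?thesis
    unfolding ZH_tilde_def
    by (intro infsum_cong) (auto simp: term_red_def weight_factor_def exp_diff exp_minus field_simps)
qed

lemma Zred_split:
  assumes "0 < \<alpha>" "x > 0" "y > 0"
  shows "Zred c n x y = ZL_tilde c n \<alpha> x y + ZH_tilde c n \<alpha> x y"
    and "0 < ZL_tilde c n \<alpha> x y" and "0 \<le> ZH_tilde c n \<alpha> x y"
proof -
  define g where "g = \<alpha> * (c - 1) / 24"
  have g: "g > 0" using assms c by (simp add: g_def)
  let ?f = "term_red n x y"
  define V where "V = {(0::real, 0::real)}"
  define L where "L = {p. n p \<noteq> 0 \<and> 0 < min (fst p) (snd p) \<and> min (fst p) (snd p) < g}"
  define I1 where "I1 = (\<lambda>J. (real J, 0::real)) ` {1::nat..}"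
  define I2 where "I2 = (\<lambda>J. (0::real, real J)) ` {1::nat..}"
  define H where "H = {p. n p \<noteq> 0 \<and> fst p \<ge> g \<and> snd p \<ge> g}"
  note summ = term_red_summable_on[OF assms(2,3)]
  \<comment> \<open>Vacuum, light primaries, two families of currents and heavy primaries;
    \<open>g > 0\<close> keeps the last apart from the vacuum and the currents.\<close>
  have cover: "{p. n p \<noteq> 0} \<subseteq> V \<union> L \<union> I1 \<union> I2 \<union> H"
  proof
    fix p assume "p \<in> {p. n p \<noteq> 0}"
    then have np: "n (fst p, snd p) \<noteq> 0" by simp
    then have nn: "fst p \<ge> 0" "snd p \<ge> 0"
      and J: "fst p = 0 \<or> snd p = 0 \<Longrightarrow> (fst p, snd p) \<noteq> (0, 0) \<Longrightarrow>
        (\<exists>J::nat. J \<ge> 1 \<and> ((fst p, snd p) = (real J, 0) \<or> (fst p, snd p) = (0, real J)))"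
      using cft unfolding is_CFT_def by blast+
    show "p \<in> V \<union> L \<union> I1 \<union> I2 \<union> H"
    proof (cases "fst p = 0 \<or> snd p = 0")
      case True
      then have "p \<in> V \<union> I1 \<union> I2"
        using J[OF True] by (cases p) (auto simp: V_def I1_def I2_def)
      then show ?thesis by auto
    next
      case False
      then have "p \<in> L \<union> H"
        using nn np by (auto simp: L_def H_def min_def not_less)
      then show ?thesis by auto
    qed
  qed
  have "Zred c n x y = infsum ?f {p. n p \<noteq> 0}"
    by (rule Zred_eq_infsum[OF assms(2,3)])
  also have "\<dots> = infsum ?f (V \<union> L \<union> I1 \<union> I2 \<union> H)"
    by (rule infsum_cong_neutral) (use cover in \<open>auto simp: term_red_def\<close>)
  also have "\<dots> = infsum ?f (V \<union> L \<union> I1 \<union> I2) + infsum ?f H"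
    by (intro infsum_Un_disjoint summ)
       (use g in \<open>auto simp: V_def L_def I1_def I2_def H_def\<close>)
  also have "infsum ?f (V \<union> L \<union> I1 \<union> I2) = infsum ?f (V \<union> L \<union> I1) + infsum ?f I2"
    by (intro infsum_Un_disjoint summ) (auto simp: V_def L_def I1_def I2_def)
  also have "infsum ?f (V \<union> L \<union> I1) = infsum ?f (V \<union> L) + infsum ?f I1"
    by (intro infsum_Un_disjoint summ) (auto simp: V_def L_def I1_def)
  also have "infsum ?f (V \<union> L) = infsum ?f V + infsum ?f L"
    by (intro infsum_Un_disjoint summ) (auto simp: V_def L_def)
  finally have total: "Zred c n x y = infsum ?f V + infsum ?f L + infsum ?f I1 + infsum ?f I2 + infsum ?f H" .
  have V: "infsum ?f V = (1 - exp (- x)) * (1 - exp (- y))"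
    using cft by (simp add: V_def term_red_def weight_factor_def is_CFT_def)
  have L: "infsum ?f L = (\<Sum>\<^sub>\<infinity>p\<in>L. real (n p) * exp (- fst p * x - snd p * y))"
    by (intro infsum_cong)
       (auto simp: L_def term_red_def weight_factor_def exp_diff exp_minus field_simps)
  have I1: "infsum ?f I1 = (\<Sum>\<^sub>\<infinity>J\<in>{1::nat..}. real (n (real J, 0)) * exp (- real J * x) * (1 - exp (- y)))"
    unfolding I1_def
    by (subst infsum_reindex)
       (auto simp: inj_on_def o_def term_red_def weight_factor_def intro!: infsum_cong)
  have I2: "infsum ?f I2 = (\<Sum>\<^sub>\<infinity>J\<in>{1::nat..}. real (n (0, real J)) * (1 - exp (- x)) * exp (- real J * y))"
    unfolding I2_def
    by (subst infsum_reindex)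
       (auto simp: inj_on_def o_def term_red_def weight_factor_def intro!: infsum_cong)
  have ZL: "ZL_tilde c n \<alpha> x y = infsum ?f V + infsum ?f L + infsum ?f I1 + infsum ?f I2"
    unfolding ZL_tilde_def V L I1 I2 by (simp add: L_def g_def)
  have ZH: "ZH_tilde c n \<alpha> x y = infsum ?f H"
    unfolding ZH_eq_infsum[OF assms(1)] H_def g_def ..
  have nn: "infsum ?f X \<ge> 0" for X
    using assms by (intro infsum_nonneg term_red_nonneg)
  show "Zred c n x y = ZL_tilde c n \<alpha> x y + ZH_tilde c n \<alpha> x y"
    unfolding total ZL ZH ..
  \<comment> \<open>The vacuum alone makes the light part strictly positive, as the final logarithm
    requires.\<close>
  have "infsum ?f V > 0" unfolding V using assms by simp
  then show "0 < ZL_tilde c n \<alpha> x y"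
    unfolding ZL using nn[of L] nn[of I1] nn[of I2] by linarith
  show "0 \<le> ZH_tilde c n \<alpha> x y" unfolding ZH by (rule nn)
qed

section \<open>Modular bounds on the heavy part\<close>

text \<open>Both weights of a heavy primary are at least \<open>g\<close>, so lowering the arguments
  gains the exponential factor in every term; afterwards the nonnegative light part is
  added.\<close>

lemma ZH_le_Zred:
  assumes "0 < \<alpha>" "0 < x'" "x' \<le> x" "0 < y'" "y' \<le> y"
  shows "ZH_tilde c n \<alpha> x y \<le> exp (- (\<alpha> * (c - 1) / 24) * (x - x' + (y - y'))) * Zred c n x' y'"
proof -
  define g where "g = \<alpha> * (c - 1) / 24"
  have g: "g > 0" using assms c by (simp add: g_def)
  define H where "H = {p. n p \<noteq> 0 \<and> fst p \<ge> g \<and> snd p \<ge> g}"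
  have ZH: "ZH_tilde c n \<alpha> u v = infsum (term_red n u v) H" for u v
    unfolding ZH_eq_infsum[OF assms(1)] H_def g_def ..
  have "infsum (term_red n x y) H \<le> infsum (\<lambda>p. exp (- g * (x - x' + (y - y'))) * term_red n x' y' p) H"
  proof (rule infsum_mono)
    show "term_red n x y summable_on H" using assms by (intro term_red_summable_on) auto
    show "(\<lambda>p. exp (- g * (x - x' + (y - y'))) * term_red n x' y' p) summable_on H"
      using assms by (intro summable_on_cmult_right term_red_summable_on) auto
    fix p assume p: "p \<in> H"
    have "g * (x - x') \<le> fst p * (x - x')" "g * (y - y') \<le> snd p * (y - y')"
      using p assms by (auto simp: H_def intro!: mult_right_mono)
    then have "exp (- fst p * x - snd p * y) \<le>
        exp (- g * (x - x' + (y - y')) + (- fst p * x' - snd p * y'))"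
      by (subst exp_le_cancel_iff) (simp add: algebra_simps)
    then have "real (n p) * exp (- fst p * x - snd p * y) \<le>
        real (n p) * (exp (- g * (x - x' + (y - y'))) * exp (- fst p * x' - snd p * y'))"
      unfolding exp_add by (intro mult_left_mono) auto
    moreover have "term_red n u v p = real (n p) * exp (- fst p * u - snd p * v)" for u v
      using p g by (auto simp: H_def term_red_def weight_factor_def mult.assoc simp flip: exp_add)
    ultimately show "term_red n x y p \<le> exp (- g * (x - x' + (y - y'))) * term_red n x' y' p"
      by (simp add: mult_ac)
  qed
  also have "\<dots> = exp (- g * (x - x' + (y - y'))) * infsum (term_red n x' y') H"
    using assms by (intro infsum_cmult_right term_red_summable_on) auto
  also have "\<dots> \<le> exp (- g * (x - x' + (y - y'))) * Zred c n x' y'"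
    using Zred_split[of \<alpha> x' y'] assms unfolding ZH by (intro mult_left_mono) auto
  finally show ?thesis by (simp only: ZH g_def)
qed

text \<open>\<open>Zpart\<close> is invariant, so the square root comes from the two
  \<open>eta\<close> factors alone.\<close>

lemma ZVir_modular:
  assumes "x > 0" "y > 0"
  shows "ZVir c n x y = sqrt (4 * pi\<^sup>2 / x * (4 * pi\<^sup>2 / y) / (4 * pi\<^sup>2)) * ZVir c n (4 * pi\<^sup>2 / x) (4 * pi\<^sup>2 / y)"
proof -
  have Z: "Zpart c n (4 * pi\<^sup>2 / x) (4 * pi\<^sup>2 / y) = Zpart c n x y"
    using cft assms unfolding is_CFT_def by metis
  have "sqrt (4 * pi\<^sup>2 / x * (4 * pi\<^sup>2 / y) / (4 * pi\<^sup>2)) * (sqrt (x / (2 * pi)) * sqrt (y / (2 * pi)))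
      = sqrt (4 * pi\<^sup>2 / x * (4 * pi\<^sup>2 / y) / (4 * pi\<^sup>2) * (x / (2 * pi) * (y / (2 * pi))))"
    by (simp only: real_sqrt_mult)
  also have "4 * pi\<^sup>2 / x * (4 * pi\<^sup>2 / y) / (4 * pi\<^sup>2) * (x / (2 * pi) * (y / (2 * pi))) = 1"
    using assms by (simp add: power2_eq_square)
  finally have "sqrt (4 * pi\<^sup>2 / x * (4 * pi\<^sup>2 / y) / (4 * pi\<^sup>2)) * (sqrt (x / (2 * pi)) * sqrt (y / (2 * pi))) = 1"
    by simp
  then have "Zpart c n x y * eta x * eta y = (sqrt (4 * pi\<^sup>2 / x * (4 * pi\<^sup>2 / y) / (4 * pi\<^sup>2)) *
      (sqrt (x / (2 * pi)) * sqrt (y / (2 * pi)))) * (Zpart c n x y * eta x * eta y)"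
    by simp
  then show ?thesis
    unfolding ZVir_def Z eta_modular[OF assms(1)] eta_modular[OF assms(2)]
    by (simp only: mult_ac)
qed

text \<open>The exponents from \<open>ZH_le_Zred\<close> and from the prefactors of
  \<open>Zred\<close> add up to \<open>A\<close> times the left side of \<open>le\<close> minus its
  right side.\<close>

lemma ZH_modular_bound:
  assumes "0 < \<alpha>" "0 < x'" "x' \<le> x" "0 < y'" "y' \<le> y"
    and le: "4 * pi\<^sup>2 / x' + 4 * pi\<^sup>2 / y' \<le> (1 - \<alpha>) * (x' + y') + \<alpha> * (x + y)"
  shows "ZH_tilde c n \<alpha> x y \<le> sqrt (4 * pi\<^sup>2 / x' * (4 * pi\<^sup>2 / y') / (4 * pi\<^sup>2)) *
      Zred c n (4 * pi\<^sup>2 / x') (4 * pi\<^sup>2 / y')"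
proof -
  define A where "A = (c - 1) / 24"
  define X where "X = 4 * pi\<^sup>2 / x'"
  define Y where "Y = 4 * pi\<^sup>2 / y'"
  define S where "S = sqrt (X * Y / (4 * pi\<^sup>2))"
  have XY: "X > 0" "Y > 0" using assms by (simp_all add: X_def Y_def)
  have A: "A > 0" using c by (simp add: A_def)
  have "ZH_tilde c n \<alpha> x y \<le> exp (- (\<alpha> * A) * (x - x' + (y - y'))) * Zred c n x' y'"
    using ZH_le_Zred[OF assms(1-5)] by (simp add: A_def)
  also have "Zred c n x' y' = exp (A * (X + Y - x' - y')) * (S * Zred c n X Y)"
  proof -
    have "exp (- A * (x' + y')) = exp (A * (X + Y - x' - y')) * exp (- A * (X + Y))"
      by (simp add: exp_add [symmetric] algebra_simps)
    then show ?thesis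
      using ZVir_modular[of x' y'] assms
      by (simp add: Zred_def A_def [symmetric] X_def [symmetric] Y_def [symmetric] S_def [symmetric])
  qed
  also have "exp (- (\<alpha> * A) * (x - x' + (y - y'))) * (exp (A * (X + Y - x' - y')) * (S * Zred c n X Y))
    = exp (A * (X + Y - (1 - \<alpha>) * (x' + y') - \<alpha> * (x + y))) * (S * Zred c n X Y)"
    by (simp add: mult.assoc [symmetric] exp_add [symmetric]) (simp add: algebra_simps)
  also have "\<dots> \<le> 1 * (S * Zred c n X Y)"
  proof (rule mult_right_mono)
    show "exp (A * (X + Y - (1 - \<alpha>) * (x' + y') - \<alpha> * (x + y))) \<le> 1"
      using A le by (simp add: X_def [symmetric] Y_def [symmetric] mult_le_0_iff)
    have "Zred c n X Y \<ge> 0" using Zred_split[of \<alpha> X Y] assms(1) XY by simp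
    then show "0 \<le> S * Zred c n X Y" using XY by (simp add: S_def)
  qed
  finally show ?thesis by (simp add: S_def X_def Y_def)
qed

lemma ZH_alg_step:
  assumes "0 < \<alpha>" "\<alpha> \<le> 1" "p \<in> region \<alpha>" "\<not> alg_stop p"
  defines "q \<equiv> alg_step \<alpha> p"
  shows "ZH_tilde c n \<alpha> (fst p) (snd p) \<le> sqrt (fst q * snd q / (4 * pi\<^sup>2)) * Zred c n (fst q) (snd q)"
proof -
  \<comment> \<open>With \<open>bt\<close> in place of \<open>b\<close> on the right this is the
    equation for \<open>t\<close>; the slack is \<open>\<alpha> * (b - bt)\<close>.\<close>
  have balance: "4 * pi\<^sup>2 / tilde_b \<alpha> b a + t_sol \<alpha> a (tilde_b \<alpha> b a) \<le>
      (1 - \<alpha>) * (tilde_b \<alpha> b a + 4 * pi\<^sup>2 / t_sol \<alpha> a (tilde_b \<alpha> b a)) + \<alpha> * (b + a)"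
    if "step \<alpha> a b" for a b
  proof -
    interpret step \<alpha> a b by fact
    have "\<alpha> * bt \<le> \<alpha> * b" using bt \<alpha> by simp
    then have "4 * pi\<^sup>2 / bt + t \<le> (1 - \<alpha>) * bt + (1 - \<alpha>) * (4 * pi\<^sup>2) / t + \<alpha> * b + \<alpha> * a"
      using t_props(2) by (simp add: left_diff_distrib)
    then show ?thesis by (simp add: distrib_left)
  qed
  from assms(1-4) show ?thesis
  proof (cases rule: alg_step_cases)
    case (1 a b)
    interpret step \<alpha> a b by fact
    \<comment> \<open>The arguments are lowered to \<open>4 * pi\<^sup>2 / t\<close> and
      \<open>bt\<close>, the duals of the next point.\<close>
    have "ZH_tilde c n \<alpha> a b \<le> sqrt (4 * pi\<^sup>2 / (4 * pi\<^sup>2 / t) * (4 * pi\<^sup>2 / bt) / (4 * pi\<^sup>2)) *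
      Zred c n (4 * pi\<^sup>2 / (4 * pi\<^sup>2 / t)) (4 * pi\<^sup>2 / bt)"
      by (rule ZH_modular_bound)
         (use \<alpha> t_props(1) bt dual_t_le balance[OF 1(1)] in \<open>auto simp: add_ac\<close>)
    then show ?thesis using t_props(1) unfolding q_def 1(3) by (simp add: 1(2))
  next
    case (2 a b)
    interpret step \<alpha> a b by fact
    have "ZH_tilde c n \<alpha> b a \<le> sqrt (4 * pi\<^sup>2 / bt * (4 * pi\<^sup>2 / (4 * pi\<^sup>2 / t)) / (4 * pi\<^sup>2)) *
      Zred c n (4 * pi\<^sup>2 / bt) (4 * pi\<^sup>2 / (4 * pi\<^sup>2 / t))"
      by (rule ZH_modular_bound)
         (use \<alpha> t_props(1) bt dual_t_le balance[OF 2(1)] in auto)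
    then show ?thesis using t_props(1) unfolding q_def 2(3) by (simp add: 2(2))
  qed
qed

lemma EVir_eq_ln_Zred:
  assumes "x > 0" "y > 0"
  shows "EVir c n x y = ln (Zred c n x y)" and "0 < Zred c n x y"
proof -
  \<comment> \<open>The threshold \<alpha> = 1 is an arbitrary choice: \<open>Zred\<close> does not
    depend on it.\<close>
  show pos: "0 < Zred c n x y" using Zred_split[of 1 x y] assms by simp
  then have "ZVir c n x y > 0" by (simp add: Zred_def zero_less_mult_iff)
  then show "EVir c n x y = ln (Zred c n x y)"
    by (simp add: EVir_def Zred_def ln_mult)
qed

end

section \<open>Iteration of the bound up to the stopping point\<close>

theorem theorem2:
  fixes \<alpha> c :: real and n :: "real \<times> real \<Rightarrow> nat" and \<beta>L \<beta>R :: real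
  assumes "0 < \<alpha>" and "\<alpha> \<le> 1" and "c > 1"
    and "is_CFT c n"
    and "(\<beta>L, \<beta>R) \<in> domD \<alpha>"
  shows "\<exists>N\<ge>1.
     (\<forall>i. 1 \<le> i \<and> i < N \<longrightarrow> \<not> alg_stop (alg_pt \<alpha> (\<beta>L, \<beta>R) i)) \<and>
     alg_stop (alg_pt \<alpha> (\<beta>L, \<beta>R) N) \<and>
     (let P = alg_pt \<alpha> (\<beta>L, \<beta>R);
          w = (\<lambda>i. \<Prod>j=2..i. sqrt (fst (P j) * snd (P j) / (4 * pi\<^sup>2)))
      in EVir c n \<beta>L \<beta>R \<le>
           ln ((\<Sum>i=1..N. w i * ZL_tilde c n \<alpha> (fst (P i)) (snd (P i)))
               + w N * ZH_tilde c n \<alpha> (fst (P N)) (snd (P N))))"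
proof -
  interpret cft c n using assms by unfold_locales
  have start: "(\<beta>L, \<beta>R) \<in> region \<alpha>" using domD_subset_region assms by blast
  define P where "P = alg_pt \<alpha> (\<beta>L, \<beta>R)"
  define w where "w = (\<lambda>i. \<Prod>j=2..i. sqrt (fst (P j) * snd (P j) / (4 * pi\<^sup>2)))"
  define ZL where "ZL = (\<lambda>i. ZL_tilde c n \<alpha> (fst (P i)) (snd (P i)))"
  define ZH where "ZH = (\<lambda>i. ZH_tilde c n \<alpha> (fst (P i)) (snd (P i)))"
  have P1: "P 1 = (\<beta>L, \<beta>R)" by (simp add: P_def alg_pt_def)
  have PSuc: "P (Suc i) = alg_step \<alpha> (P i)" if "i \<ge> 1" for i
    using that by (cases i) (simp_all add: P_def alg_pt_def)
  define k where "k = (LEAST k. alg_stop ((alg_step \<alpha> ^^ k) (\<beta>L, \<beta>R)))"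
  \<comment> \<open>Points are numbered from 1, so \<open>k\<close> steps reach point
    \<open>k + 1\<close>.\<close>
  define N where "N = Suc k"
  have stop: "alg_stop (P N)"
    using LeastI_ex[OF alg_terminates[OF assms(1,2) start]]
    by (simp add: N_def k_def P_def alg_pt_def)
  have nonstop: "\<not> alg_stop (P i)" if "1 \<le> i" "i < N" for i
    using not_less_Least[of "i - 1" "\<lambda>k. alg_stop ((alg_step \<alpha> ^^ k) (\<beta>L, \<beta>R))"] that
    by (simp add: N_def k_def P_def alg_pt_def)
  \<comment> \<open>The bound truncated at \<open>M\<close>: going to \<open>M + 1\<close> replaces
    the heavy remainder by the light and heavy parts at the next point. At \<open>M = 1\<close> the
    weight is an empty product.\<close>
  have ind: "P M \<in> region \<alpha> \<and> w M \<ge> 0 \<and> Zred c n \<beta>L \<beta>R \<le> (\<Sum>i=1..M. w i * ZL i) + w M * ZH M"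
    if "1 \<le> M" "M \<le> N" for M
    using that
  proof (induction M rule: nat_induct_at_least)
    case base
    then show ?case
      using start P1 Zred_split[OF assms(1), of \<beta>L \<beta>R] region_pos[OF start]
      by (simp add: w_def ZL_def ZH_def)
  next
    case (Suc M)
    then have IH: "P M \<in> region \<alpha>" "w M \<ge> 0"
        "Zred c n \<beta>L \<beta>R \<le> (\<Sum>i=1..M. w i * ZL i) + w M * ZH M" by simp_all
    have M: "\<not> alg_stop (P M)" using nonstop Suc by simp
    define r where "r = sqrt (fst (P (Suc M)) * snd (P (Suc M)) / (4 * pi\<^sup>2))"
    have reg: "P (Suc M) \<in> region \<alpha>"
      using alg_step_region[OF assms(1,2) IH(1) M] PSuc Suc by simp
    have r: "r \<ge> 0" using region_pos[OF reg] by (simp add: r_def)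
    have wS: "w (Suc M) = w M * r"
      using Suc(1) by (simp add: w_def r_def)
    have "ZH M \<le> r * (ZL (Suc M) + ZH (Suc M))"
      using ZH_alg_step[OF assms(1,2) IH(1) M] PSuc[OF Suc(1)] region_pos[OF reg]
        Zred_split(1)[OF assms(1), of "fst (P (Suc M))" "snd (P (Suc M))"]
      by (simp add: ZH_def ZL_def r_def)
    then have "w M * ZH M \<le> w M * (r * (ZL (Suc M) + ZH (Suc M)))"
      using IH(2) by (rule mult_left_mono)
    also have "\<dots> = w (Suc M) * ZL (Suc M) + w (Suc M) * ZH (Suc M)"
      by (simp add: wS algebra_simps)
    finally show ?case using IH r reg by (simp add: wS)
  qed
  have pos: "\<beta>L > 0" "\<beta>R > 0" using region_pos[OF start] by simp_all
  have "EVir c n \<beta>L \<beta>R \<le> ln ((\<Sum>i=1..N. w i * ZL i) + w N * ZH N)"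
    unfolding EVir_eq_ln_Zred(1)[OF pos]
    using ind[of N] EVir_eq_ln_Zred(2)[OF pos] by (subst ln_le_cancel_iff) (auto simp: N_def)
  then show ?thesis
    using stop nonstop unfolding Let_def P_def w_def ZL_def ZH_def
    by (intro exI[of _ N]) (auto simp: N_def)
qed

end
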